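(* Let $f : M \to \bar M$ be a totally geodesic immersion of a $p$-dimensional manifold $M$ into an $n$-dimensional Einstein manifold $\bar M$ with (constant) scalar curvature $s$. Let $J$ be the Jacobi operator of the immersion, acting on smooth sections of the normal bundle $NM$. Then the following are true. (1) $J = -\Delta_M - \frac{s}{n} I + Ric^\perp$. (2) If $M$ is a hypersurface (i.e. $p = n-1$), then $J = -\Delta_M - \frac{s}{n} I$. (3) If $\bar M$ is of constant (sectional) curvature, then $J = -\Delta_M - s\,\frac{p}{n(n-1)}\, I$.
   Context: $\bar M$ is a Riemannian manifold that is Einstein, i.e. $Ric = \lambda g$ with $\lambda$ constant, so that $\lambda = s/n$. $M$ carries the induced metric, $NM$ is the normal bundle of the immersion, and $(\cdot)^N$ denotes orthogonal projection to $NM$. The immersion is totally geodesic if its second fundamental form vanishes identically. $I$ is the identity operator on sections of $NM$. The curvature tensor of $\bar M$ is $\bar R_{XY}Z = \bar\nabla_X\bar\nabla_Y Z - \bar\nabla_Y\bar\nabla_X Z - \bar\nabla_{[X,Y]}Z$, so that on a space of constant sectional curvature $k_0$ one has $\bar R_{XY}Z = k_0(\langle Y,Z\rangle X - \langle X,Z\rangle Y)$. The Jacobi operator $J : C^\infty(NM) \to C^\infty(NM)$ is defined by $$J = -\mathrm{tr}\,\nabla^2 + \bar R - \tilde S,$$ where: - $\mathrm{tr}\,\nabla^2$ is the trace over $TM$ of the second covariant derivative on sections of $NM$, using the normal connection; it is denoted $\Delta_M := \mathrm{tr}\,\nabla^2$. - $\bar R$ is the partial Ricci operator: $\bar R V :=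 \sum_{i=1}^p (\bar R_{E_i V}E_i)^N$ for $V \in NM_m$ and $E_1,\dots,E_p$ an orthonormal basis of $TM_m$. - $\tilde S = {}^{\mathsf T}S\circ S$, where the shape operator is regarded as a map $S : NM \to Sym^2(TM)$ and ${}^{\mathsf T}S$ is its transpose. The Ricci curvature of the normal bundle is the operator $Ric^\perp : NM \to NM$, $Ric^\perp(V) = -\sum_{i=1}^{n-p} (\bar R_{V_i V}V_i)^N$, where $V_1,\dots,V_{n-p}$ is an orthonormal basis of $NM_m$. *)

theory Defs
  imports "HOL-Analysis.Analysis"
begin

section \<open>Smooth functions on open subsets of Euclidean spaces\<close>

primrec Ck_on :: "nat \<Rightarrow> 'x set \<Rightarrow> ('x::real_normed_vector \<Rightarrow> 'y::real_normed_vector) \<Rightarrow> bool" where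
  "Ck_on 0 S f \<longleftrightarrow> continuous_on S f"
| "Ck_on (Suc k) S f \<longleftrightarrow>
     (\<forall>x\<in>S. f differentiable (at x)) \<and>
     (\<forall>v. Ck_on k S (\<lambda>x. frechet_derivative f (at x) v))"

definition smooth_on :: "'x set \<Rightarrow> ('x::real_normed_vector \<Rightarrow> 'y::real_normed_vector) \<Rightarrow> bool" where
  "smooth_on S f \<longleftrightarrow> (\<forall>k. Ck_on k S f)"


section \<open>Manifolds and Riemannian metrics\<close>

text \<open>
  A chart is a pair (domain, coordinate map). A manifold is modelled on a Euclidean space
  \<open>'e\<close>; its dimension is \<open>DIM('e)\<close>. Besides an atlas, the structure carries a choice
  \<open>chart_at\<close> of one chart of the atlas around every point. The tangent space at \<open>x\<close> is
  the vector space \<open>'e\<close>, a tangent vector being represented by its components with respect to the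
  chart \<open>chart_at x\<close>; components in the other charts are obtained by differentiating the
  coordinate changes. Accordingly a vector field is a function from points to \<open>'e\<close>,
  and the metric at \<open>x\<close> is a bilinear form on \<open>'e\<close>. Nothing is assumed about how
  \<open>chart_at\<close> varies with the point, so smoothness is always expressed in the components
  with respect to a fixed chart.
\<close>

type_synonym ('a, 'e) chart = "'a set \<times> ('a \<Rightarrow> 'e)"

record ('a, 'e) riem =
  top_of :: "'a topology"
  atlas :: "('a, 'e) chart set"
  chart_at :: "'a \<Rightarrow> ('a, 'e) chart"
  metric :: "'a \<Rightarrow> 'e \<Rightarrow> 'e \<Rightarrow> real"

definition points :: "('a, 'e) riem \<Rightarrow> 'a set" where
  "points N = topspace (top_of N)"

definition chart_inv :: "('a, 'e) chart \<Rightarrow> 'e \<Rightarrow> 'a" where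
  "chart_inv c = inv_into (fst c) (snd c)"

definition chart_on :: "'a topology \<Rightarrow> ('a, 'e::euclidean_space) chart \<Rightarrow> bool" where
  "chart_on X c \<longleftrightarrow>
     openin X (fst c) \<and> open (snd c ` fst c) \<and>
     homeomorphic_map (subtopology X (fst c)) (top_of_set (snd c ` fst c)) (snd c)"

definition smooth_manifold :: "('a, 'e::euclidean_space) riem \<Rightarrow> bool" where
  "smooth_manifold N \<longleftrightarrow>
     Hausdorff_space (top_of N) \<and> second_countable (top_of N) \<and>
     (\<forall>c\<in>atlas N. chart_on (top_of N) c) \<and>
     (\<forall>c\<in>atlas N. \<forall>d\<in>atlas N.
        smooth_on (snd c ` (fst c \<inter> fst d)) (snd d \<circ> chart_inv c)) \<and>
     (\<forall>x\<in>points N. chart_at N x \<in> atlas N \<and> x \<in> fst (chart_at N x))"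

definition tangent_change ::
  "('a, 'e::euclidean_space) chart \<Rightarrow> ('a, 'e) chart \<Rightarrow> 'a \<Rightarrow> 'e \<Rightarrow> 'e" where
  "tangent_change c d x = frechet_derivative (snd d \<circ> chart_inv c) (at (snd c x))"

text \<open>
  The components in \<open>c\<close> of a tangent vector at \<open>x\<close>, and the tangent vector at \<open>x\<close>
  with given components in \<open>c\<close>.
\<close>

definition comps :: "('a, 'e::euclidean_space) riem \<Rightarrow> ('a, 'e) chart \<Rightarrow> 'a \<Rightarrow> 'e \<Rightarrow> 'e" where
  "comps N c x = tangent_change (chart_at N x) c x"

definition of_comps :: "('a, 'e::euclidean_space) riem \<Rightarrow> ('a, 'e) chart \<Rightarrow> 'a \<Rightarrow> 'e \<Rightarrow> 'e" where
  "of_comps N c x = tangent_change c (chart_at N x) x"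

text \<open>The metric read in the chart \<open>c\<close>, as a function of the coordinate \<open>\<xi>\<close>.\<close>

definition chart_metric ::
  "('a, 'e::euclidean_space) riem \<Rightarrow> ('a, 'e) chart \<Rightarrow> 'e \<Rightarrow> 'e \<Rightarrow> 'e \<Rightarrow> real" where
  "chart_metric N c \<xi> u v =
     (let x = chart_inv c \<xi> in metric N x (of_comps N c x u) (of_comps N c x v))"

definition inner_product :: "('e::real_vector \<Rightarrow> 'e \<Rightarrow> real) \<Rightarrow> bool" where
  "inner_product h \<longleftrightarrow>
     bilinear h \<and> (\<forall>u v. h u v = h v u) \<and> (\<forall>u. u \<noteq> 0 \<longrightarrow> h u u > 0)"

definition riemannian_manifold :: "('a, 'e::euclidean_space) riem \<Rightarrow> bool" where
  "riemannian_manifold N \<longleftrightarrow>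
     smooth_manifold N \<and>
     (\<forall>x\<in>points N. inner_product (metric N x)) \<and>
     (\<forall>c\<in>atlas N. \<forall>u v. smooth_on (snd c ` fst c) (\<lambda>\<xi>. chart_metric N c \<xi> u v))"

text \<open>Orthonormal bases of a subspace \<open>W\<close> with respect to an inner product \<open>h\<close>.\<close>

definition orthonormal_basis :: "('e::real_vector \<Rightarrow> 'e \<Rightarrow> real) \<Rightarrow> 'e set \<Rightarrow> 'e set \<Rightarrow> bool" where
  "orthonormal_basis h W B \<longleftrightarrow>
     finite B \<and> B \<subseteq> W \<and> W = span B \<and>
     (\<forall>a\<in>B. \<forall>b\<in>B. h a b = (if a = b then 1 else 0))"

definition onb :: "('e::real_vector \<Rightarrow> 'e \<Rightarrow> real) \<Rightarrow> 'e set \<Rightarrow> 'e set" where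
  "onb h W = (SOME B. orthonormal_basis h W B)"


section \<open>Levi-Civita connection and curvature\<close>

text \<open>
  In the chart \<open>c\<close> a connection is \<open>\<nabla>\<^sub>X Y = DY(X) + \<Gamma>(X, Y)\<close> with \<open>\<Gamma>\<close> bilinear. The
  Levi-Civita connection is the torsion-free one (\<open>\<Gamma>\<close> symmetric) compatible with the metric
  (\<open>w g(u, v) = g(\<nabla>\<^sub>w u, v) + g(u, \<nabla>\<^sub>w v)\<close> for fields \<open>u\<close>, \<open>v\<close>
  with constant components).
\<close>

definition christoffel ::
  "('a, 'e::euclidean_space) riem \<Rightarrow> ('a, 'e) chart \<Rightarrow> 'e \<Rightarrow> 'e \<Rightarrow> 'e \<Rightarrow> 'e" where
  "christoffel N c \<xi> = (THE \<Gamma>. bilinear \<Gamma> \<and> (\<forall>u v. \<Gamma> u v = \<Gamma> v u) \<and>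
     (\<forall>w u v. frechet_derivative (\<lambda>\<eta>. chart_metric N c \<eta> u v) (at \<xi>) w =
        chart_metric N c \<xi> (\<Gamma> w u) v + chart_metric N c \<xi> u (\<Gamma> w v)))"

text \<open>
  Vector fields on a chart domain are given here by their components, as functions of the
  coordinate.
\<close>

definition levi_civita ::
  "('a, 'e::euclidean_space) riem \<Rightarrow> ('a, 'e) chart \<Rightarrow> ('e \<Rightarrow> 'e) \<Rightarrow> ('e \<Rightarrow> 'e) \<Rightarrow> 'e \<Rightarrow> 'e" where
  "levi_civita N c X Y \<xi> =
     frechet_derivative Y (at \<xi>) (X \<xi>) + christoffel N c \<xi> (X \<xi>) (Y \<xi>)"

definition lie_bracket :: "('e::real_normed_vector \<Rightarrow> 'e) \<Rightarrow> ('e \<Rightarrow> 'e) \<Rightarrow> 'e \<Rightarrow> 'e" where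
  "lie_bracket X Y \<xi> =
     frechet_derivative Y (at \<xi>) (X \<xi>) - frechet_derivative X (at \<xi>) (Y \<xi>)"

definition curvature_field ::
  "('a, 'e::euclidean_space) riem \<Rightarrow> ('a, 'e) chart \<Rightarrow>
     ('e \<Rightarrow> 'e) \<Rightarrow> ('e \<Rightarrow> 'e) \<Rightarrow> ('e \<Rightarrow> 'e) \<Rightarrow> 'e \<Rightarrow> 'e" where
  "curvature_field N c X Y Z \<xi> =
     levi_civita N c X (levi_civita N c Y Z) \<xi>
     - levi_civita N c Y (levi_civita N c X Z) \<xi>
     - levi_civita N c (lie_bracket X Y) Z \<xi>"

text \<open>
  The value of the curvature tensor on tangent vectors \<open>u\<close>, \<open>v\<close>, \<open>w\<close> at \<open>x\<close>:
  the expression being tensorial, the vectors may be extended to fields arbitrarily, and the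
  extensions used are those with constant components in \<open>chart_at N x\<close>.
\<close>

definition curvature ::
  "('a, 'e::euclidean_space) riem \<Rightarrow> 'a \<Rightarrow> 'e \<Rightarrow> 'e \<Rightarrow> 'e \<Rightarrow> 'e" where
  "curvature N x u v w =
     curvature_field N (chart_at N x) (\<lambda>_. u) (\<lambda>_. v) (\<lambda>_. w) (snd (chart_at N x) x)"

definition ricci :: "('a, 'e::euclidean_space) riem \<Rightarrow> 'a \<Rightarrow> 'e \<Rightarrow> 'e \<Rightarrow> real" where
  "ricci N x u v =
     (\<Sum>e\<in>onb (metric N x) UNIV. metric N x (curvature N x e u v) e)"

definition scalar_curvature :: "('a, 'e::euclidean_space) riem \<Rightarrow> 'a \<Rightarrow> real" where
  "scalar_curvature N x = (\<Sum>e\<in>onb (metric N x) UNIV. ricci N x e e)"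

definition einstein :: "('a, 'e::euclidean_space) riem \<Rightarrow> bool" where
  "einstein N \<longleftrightarrow>
     (\<exists>l. \<forall>x\<in>points N. \<forall>u v. ricci N x u v = l * metric N x u v)"

definition sectional_curvature :: "('a, 'e::euclidean_space) riem \<Rightarrow> 'a \<Rightarrow> 'e \<Rightarrow> 'e \<Rightarrow> real" where
  "sectional_curvature N x u v =
     metric N x (curvature N x u v v) u /
     (metric N x u u * metric N x v v - (metric N x u v)\<^sup>2)"

definition constant_curvature :: "('a, 'e::euclidean_space) riem \<Rightarrow> bool" where
  "constant_curvature N \<longleftrightarrow>
     (\<exists>k. \<forall>x\<in>points N. \<forall>u v. u \<noteq> v \<and> independent {u, v} \<longrightarrow>
        sectional_curvature N x u v = k)"


section \<open>Immersions and the normal bundle\<close>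

definition smooth_map ::
  "('m, 'b::euclidean_space) riem \<Rightarrow> ('a, 'e::euclidean_space) riem \<Rightarrow> ('m \<Rightarrow> 'a) \<Rightarrow> bool" where
  "smooth_map M N f \<longleftrightarrow>
     continuous_map (top_of M) (top_of N) f \<and>
     (\<forall>c\<in>atlas M. \<forall>d\<in>atlas N.
        smooth_on (snd c ` (fst c \<inter> f -` fst d)) (snd d \<circ> f \<circ> chart_inv c))"

definition differential ::
  "('m, 'b::euclidean_space) riem \<Rightarrow> ('a, 'e::euclidean_space) riem \<Rightarrow> ('m \<Rightarrow> 'a) \<Rightarrow> 'm \<Rightarrow> 'b \<Rightarrow> 'e"
  where
  "differential M N f m =
     frechet_derivative (snd (chart_at N (f m)) \<circ> f \<circ> chart_inv (chart_at M m))
       (at (snd (chart_at M m) m))"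

definition immersion ::
  "('m, 'b::euclidean_space) riem \<Rightarrow> ('a, 'e::euclidean_space) riem \<Rightarrow> ('m \<Rightarrow> 'a) \<Rightarrow> bool" where
  "immersion M N f \<longleftrightarrow> smooth_map M N f \<and> (\<forall>m\<in>points M. inj (differential M N f m))"

definition induced_metric ::
  "('m, 'b::euclidean_space) riem \<Rightarrow> ('a, 'e::euclidean_space) riem \<Rightarrow> ('m \<Rightarrow> 'a) \<Rightarrow> bool" where
  "induced_metric M N f \<longleftrightarrow>
     (\<forall>m\<in>points M. \<forall>u v.
        metric M m u v = metric N (f m) (differential M N f m u) (differential M N f m v))"

definition normal_space ::
  "('m, 'b::euclidean_space) riem \<Rightarrow> ('a, 'e::euclidean_space) riem \<Rightarrow> ('m \<Rightarrow> 'a) \<Rightarrow> 'm \<Rightarrow> 'e set"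
  where
  "normal_space M N f m = {v. \<forall>u. metric N (f m) v (differential M N f m u) = 0}"

definition normal_part ::
  "('m, 'b::euclidean_space) riem \<Rightarrow> ('a, 'e::euclidean_space) riem \<Rightarrow> ('m \<Rightarrow> 'a) \<Rightarrow> 'm \<Rightarrow> 'e \<Rightarrow> 'e"
  where
  "normal_part M N f m v =
     (THE w. w \<in> normal_space M N f m \<and> v - w \<in> range (differential M N f m))"

definition normal_sections ::
  "('m, 'b::euclidean_space) riem \<Rightarrow> ('a, 'e::euclidean_space) riem \<Rightarrow> ('m \<Rightarrow> 'a) \<Rightarrow> ('m \<Rightarrow> 'e) set"
  where
  "normal_sections M N f =
     {V. (\<forall>m\<in>points M. V m \<in> normal_space M N f m) \<and>
         (\<forall>c\<in>atlas M. \<forall>d\<in>atlas N.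
            smooth_on (snd c ` (fst c \<inter> f -` fst d))
              (\<lambda>\<xi>. let m = chart_inv c \<xi> in comps N d (f m) (V m)))}"

text \<open>
  The covariant derivative, in the direction of the tangent vector \<open>u\<close> of \<open>M\<close> at \<open>m\<close>,
  of a vector field \<open>V\<close> along \<open>f\<close>, for the pullback of the Levi-Civita connection of
  \<open>N\<close>: in charts, \<open>\<nabla>\<^sub>u V = DV(u) + \<Gamma>(df(u), V)\<close>.
\<close>

definition nabla_along ::
  "('m, 'b::euclidean_space) riem \<Rightarrow> ('a, 'e::euclidean_space) riem \<Rightarrow> ('m \<Rightarrow> 'a) \<Rightarrow>
     ('m \<Rightarrow> 'e) \<Rightarrow> 'm \<Rightarrow> 'b \<Rightarrow> 'e" where
  "nabla_along M N f V m u =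
     (let c = chart_at M m; d = chart_at N (f m) in
        frechet_derivative (\<lambda>\<xi>. let m' = chart_inv c \<xi> in comps N d (f m') (V m'))
          (at (snd c m)) u
        + christoffel N d (snd d (f m)) (differential M N f m u) (V m))"

definition nabla_perp ::
  "('m, 'b::euclidean_space) riem \<Rightarrow> ('a, 'e::euclidean_space) riem \<Rightarrow> ('m \<Rightarrow> 'a) \<Rightarrow>
     ('m \<Rightarrow> 'e) \<Rightarrow> 'm \<Rightarrow> 'b \<Rightarrow> 'e" where
  "nabla_perp M N f V m u = normal_part M N f m (nabla_along M N f V m u)"

text \<open>
  The extension of a tangent vector \<open>v\<close> at \<open>m\<close> to a vector field near \<open>m\<close> with constant
  components in the chart at \<open>m\<close>. It serves to evaluate tensorial expressions at \<open>m\<close>, which do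
  not depend on the extension; only its values on the domain of that chart matter.
\<close>

definition extension :: "('m, 'b::euclidean_space) riem \<Rightarrow> 'm \<Rightarrow> 'b \<Rightarrow> 'm \<Rightarrow> 'b" where
  "extension M m v m' = of_comps M (chart_at M m) m' v"

definition second_fundamental_form ::
  "('m, 'b::euclidean_space) riem \<Rightarrow> ('a, 'e::euclidean_space) riem \<Rightarrow> ('m \<Rightarrow> 'a) \<Rightarrow>
     'm \<Rightarrow> 'b \<Rightarrow> 'b \<Rightarrow> 'e" where
  "second_fundamental_form M N f m u v =
     normal_part M N f m
       (nabla_along M N f (\<lambda>m'. differential M N f m' (extension M m v m')) m u)"

definition totally_geodesic ::
  "('m, 'b::euclidean_space) riem \<Rightarrow> ('a, 'e::euclidean_space) riem \<Rightarrow> ('m \<Rightarrow> 'a) \<Rightarrow> bool" where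
  "totally_geodesic M N f \<longleftrightarrow>
     (\<forall>m\<in>points M. \<forall>u v. second_fundamental_form M N f m u v = 0)"


section \<open>The Jacobi operator\<close>

text \<open>
  \<open>\<nabla>\<^sup>2\<^sub>u\<^sub>,\<^sub>v V = \<nabla>\<^sub>u \<nabla>\<^sub>Y V - \<nabla>\<^sub>Z V\<close> at \<open>m\<close>, for the normal connection, where
  \<open>Y\<close> extends \<open>v\<close> and \<open>Z\<close> is the Levi-Civita derivative in \<open>M\<close> of \<open>Y\<close> in the direction \<open>u\<close>.
\<close>

definition nabla2 ::
  "('m, 'b::euclidean_space) riem \<Rightarrow> ('a, 'e::euclidean_space) riem \<Rightarrow> ('m \<Rightarrow> 'a) \<Rightarrow>
     ('m \<Rightarrow> 'e) \<Rightarrow> 'm \<Rightarrow> 'b \<Rightarrow> 'b \<Rightarrow> 'e" where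
  "nabla2 M N f V m u v =
     nabla_perp M N f (\<lambda>m'. nabla_perp M N f V m' (extension M m v m')) m u
     - nabla_perp M N f V m
         (levi_civita M (chart_at M m) (\<lambda>_. u) (\<lambda>_. v) (snd (chart_at M m) m))"

definition laplacian ::
  "('m, 'b::euclidean_space) riem \<Rightarrow> ('a, 'e::euclidean_space) riem \<Rightarrow> ('m \<Rightarrow> 'a) \<Rightarrow>
     ('m \<Rightarrow> 'e) \<Rightarrow> 'm \<Rightarrow> 'e" where
  "laplacian M N f V m = (\<Sum>e\<in>onb (metric M m) UNIV. nabla2 M N f V m e e)"

definition partial_ricci ::
  "('m, 'b::euclidean_space) riem \<Rightarrow> ('a, 'e::euclidean_space) riem \<Rightarrow> ('m \<Rightarrow> 'a) \<Rightarrow>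
     'm \<Rightarrow> 'e \<Rightarrow> 'e" where
  "partial_ricci M N f m v =
     (\<Sum>e\<in>onb (metric N (f m)) (range (differential M N f m)).
        normal_part M N f m (curvature N (f m) e v e))"

definition ricci_perp ::
  "('m, 'b::euclidean_space) riem \<Rightarrow> ('a, 'e::euclidean_space) riem \<Rightarrow> ('m \<Rightarrow> 'a) \<Rightarrow>
     'm \<Rightarrow> 'e \<Rightarrow> 'e" where
  "ricci_perp M N f m v =
     - (\<Sum>e\<in>onb (metric N (f m)) (normal_space M N f m).
          normal_part M N f m (curvature N (f m) e v e))"

text \<open>
  The shape operator \<open>S\<^sub>v\<close> of a normal vector \<open>v\<close> is the self-adjoint endomorphism of the
  tangent space of \<open>M\<close> with \<open>\<langle>S\<^sub>v a, b\<rangle> = \<langle>II(a, b), v\<rangle>\<close>. Symmetric endomorphisms carry the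
  inner product \<open>tr (AB)\<close>, with respect to which the transpose of \<open>S\<close> is taken.
\<close>

definition shape_operator ::
  "('m, 'b::euclidean_space) riem \<Rightarrow> ('a, 'e::euclidean_space) riem \<Rightarrow> ('m \<Rightarrow> 'a) \<Rightarrow>
     'm \<Rightarrow> 'e \<Rightarrow> 'b \<Rightarrow> 'b" where
  "shape_operator M N f m v a =
     (THE w. \<forall>b. metric M m w b = metric N (f m) (second_fundamental_form M N f m a b) v)"

definition sym2_inner ::
  "('m, 'b::euclidean_space) riem \<Rightarrow> 'm \<Rightarrow> ('b \<Rightarrow> 'b) \<Rightarrow> ('b \<Rightarrow> 'b) \<Rightarrow> real" where
  "sym2_inner M m A B = (\<Sum>e\<in>onb (metric M m) UNIV. metric M m (A e) (B e))"

definition shape_transpose ::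
  "('m, 'b::euclidean_space) riem \<Rightarrow> ('a, 'e::euclidean_space) riem \<Rightarrow> ('m \<Rightarrow> 'a) \<Rightarrow>
     'm \<Rightarrow> ('b \<Rightarrow> 'b) \<Rightarrow> 'e" where
  "shape_transpose M N f m A =
     (THE w. w \<in> normal_space M N f m \<and>
        (\<forall>v\<in>normal_space M N f m.
           metric N (f m) w v = sym2_inner M m A (shape_operator M N f m v)))"

definition S_tilde ::
  "('m, 'b::euclidean_space) riem \<Rightarrow> ('a, 'e::euclidean_space) riem \<Rightarrow> ('m \<Rightarrow> 'a) \<Rightarrow>
     'm \<Rightarrow> 'e \<Rightarrow> 'e" where
  "S_tilde M N f m v = shape_transpose M N f m (shape_operator M N f m v)"

definition jacobi ::
  "('m, 'b::euclidean_space) riem \<Rightarrow> ('a, 'e::euclidean_space) riem \<Rightarrow> ('m \<Rightarrow> 'a) \<Rightarrow>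
     ('m \<Rightarrow> 'e) \<Rightarrow> 'm \<Rightarrow> 'e" where
  "jacobi M N f V m =
     - laplacian M N f V m + partial_ricci M N f m (V m) - S_tilde M N f m (V m)"

end

theory Submission
  imports Defs
begin

text \<open>
  Since the second fundamental form vanishes, so does \<open>S_tilde\<close>, and the statement becomes a
  pointwise identity for the partial Ricci operator. Orthonormal bases of the tangent and the
  normal space combine to one of the ambient space, over which \<open>R(e, v) e\<close> sums to \<open>-Ric v\<close>;
  this gives (1). For a hypersurface the normal sum has the single term \<open>R(e, v) e = 0\<close> with \<open>v\<close> a
  multiple of \<open>e\<close>. In constant curvature \<open>k\<close> the tangential sum is \<open>-p k v\<close>, and
  \<open>s = n (n - 1) k\<close>. All of this needs the algebraic symmetries of the curvature operator, which in a
  chart come from the symmetry of the Christoffel form, metric compatibility and the symmetry of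
  second derivatives, once the Christoffel form is known to be differentiable.
\<close>

section \<open>Inner products and algebraic curvature tensors\<close>

locale inner_form =
  fixes h :: "'e::euclidean_space \<Rightarrow> 'e \<Rightarrow> real"
  assumes inner_product: "inner_product h"
begin

lemma bilinear: "bilinear h"
  and commute: "h u v = h v u"
  and pos: "u \<noteq> 0 \<Longrightarrow> h u u > 0"
  using inner_product unfolding inner_product_def by auto

lemmas simps =
  bilinear_ladd[OF bilinear] bilinear_radd[OF bilinear]
  bilinear_lsub[OF bilinear] bilinear_rsub[OF bilinear]
  bilinear_lmul[OF bilinear] bilinear_rmul[OF bilinear]
  bilinear_lneg[OF bilinear] bilinear_rneg[OF bilinear]
  bilinear_lzero[OF bilinear] bilinear_rzero[OF bilinear]

lemma sum_left: "h (sum f A) v = (\<Sum>a\<in>A. h (f a) v)"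
  using bilinear linear_sum[of "\<lambda>u. h u v" f A]
  unfolding bilinear_def by auto

lemma eq_zero_iff: "h u u = 0 \<longleftrightarrow> u = 0"
  using pos[of u] by (cases "u = 0") (auto simp: simps)

lemma eqI: "(\<And>w. h u w = h v w) \<Longrightarrow> u = v"
  using eq_zero_iff[of "u - v"] by (simp add: simps)

section \<open>Orthonormal systems: expansion, Parseval, extension, traces\<close>

definition orthonormal :: "'e set \<Rightarrow> bool" where
  "orthonormal B \<longleftrightarrow> finite B \<and> (\<forall>a\<in>B. \<forall>b\<in>B. h a b = (if a = b then 1 else 0))"

lemma orthonormal_basis_iff:
  "orthonormal_basis h W B \<longleftrightarrow> orthonormal B \<and> W = span B"
  unfolding orthonormal_basis_def orthonormal_def using span_superset by auto

lemma orthonormal_basisD: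
  assumes "orthonormal_basis h W B"
  shows "orthonormal B" "finite B" "B \<subseteq> W" "span B = W" "\<And>b. b \<in> B \<Longrightarrow> h b b = 1"
  using assms unfolding orthonormal_basis_def orthonormal_def by auto

lemma orthonormal_coeff:
  assumes "orthonormal B" "b \<in> B"
  shows "h (\<Sum>a\<in>B. c a *\<^sub>R a) b = c b"
proof -
  have "h (\<Sum>a\<in>B. c a *\<^sub>R a) b = (\<Sum>a\<in>B. if a = b then c a else 0)"
    using assms unfolding sum_left simps orthonormal_def by (intro sum.cong) auto
  then show ?thesis using assms by (simp add: orthonormal_def)
qed

lemma orthonormal_expand:
  assumes "orthonormal B" "v \<in> span B"
  shows "v = (\<Sum>b\<in>B. h v b *\<^sub>R b)"
proof -
  have "finite B" using assms by (simp add: orthonormal_def)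
  with assms obtain c where c: "v = (\<Sum>b\<in>B. c b *\<^sub>R b)"
    by (auto simp: span_finite)
  then have "h v b = c b" if "b \<in> B" for b
    using orthonormal_coeff[OF assms(1) that] by simp
  then show ?thesis using c by (metis (no_types, lifting) sum.cong)
qed

lemma orthonormal_parseval:
  assumes "orthonormal B" "v \<in> span B"
  shows "(\<Sum>b\<in>B. h v b * h w b) = h v w"
  by (subst (2) orthonormal_expand[OF assms])
    (auto simp: sum_left simps commute[of w] intro!: sum.cong)

lemma orthonormal_independent:
  assumes "orthonormal B"
  shows "independent B"
proof -
  have "finite B" using assms by (simp add: orthonormal_def)
  moreover have "c b = 0" if "(\<Sum>a\<in>B. c a *\<^sub>R a) = 0" "b \<in> B" for c b
    using orthonormal_coeff[OF assms that(2), of c] that(1) by (simp add: simps)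
  ultimately show ?thesis by (metis independent_if_scalars_zero)
qed

lemma orthonormal_basis_card:
  assumes "orthonormal_basis h W B"
  shows "card B = dim W"
  using assms orthonormal_independent
  by (metis dim_eq_card_independent dim_span orthonormal_basis_iff)

text \<open>By Parseval, \<open>v\<close> and its expansion along \<open>B\<close> have the same
  pairing with any \<open>x\<close> in the span. This drives both the extension of orthonormal
  systems and the formula for orthogonal projection.\<close>

lemma residual_orthogonal:
  assumes "orthonormal B" "x \<in> span B"
  shows "h (v - (\<Sum>b\<in>B. h v b *\<^sub>R b)) x = 0"
proof -
  have "h v x = (\<Sum>b\<in>B. h v b * h x b)"
    using orthonormal_parseval[OF assms, of v] by (simp add: commute mult.commute)
  then show ?thesis
    by (simp add: simps sum_left) (auto simp: commute intro!: sum.cong)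
qed

text \<open>Independence bounds the size of orthonormal subsets of \<open>W\<close>, so a largest
  one exists. It spans \<open>W\<close>: otherwise the normalised residual of a vector outside its
  span could be added to it.\<close>

lemma ex_orthonormal_basis:
  assumes "subspace W"
  shows "\<exists>B. orthonormal_basis h W B"
proof -
  let ?P = "\<lambda>k. \<exists>B. orthonormal B \<and> B \<subseteq> W \<and> card B = k"
  have "?P 0"
    by (rule exI[of _ "{}"]) (auto simp: orthonormal_def)
  moreover have "k \<le> DIM('e)" if "?P k" for k
    using that orthonormal_independent independent_bound by blast
  ultimately obtain k where k: "?P k" "\<And>l. ?P l \<Longrightarrow> l \<le> k"
    using Nat.ex_has_greatest_nat[of ?P 0 "DIM('e)"] by blast
  then obtain B where B: "orthonormal B" "B \<subseteq> W" "card B = k" by blast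
  have "W \<subseteq> span B"
  proof (rule ccontr)
    assume "\<not> W \<subseteq> span B"
    then obtain w where w: "w \<in> W" "w \<notin> span B" by blast
    define r where "r = w - (\<Sum>b\<in>B. h w b *\<^sub>R b)"
    have sB: "(\<Sum>b\<in>B. h w b *\<^sub>R b) \<in> span B"
      by (simp add: span_base span_scale span_sum)
    moreover have "span B \<subseteq> W" using B assms span_minimal by blast
    ultimately have "r \<in> W" using w assms unfolding r_def by (blast intro: subspace_diff)
    have "r \<noteq> 0" using w sB unfolding r_def by auto
    then have rr: "h r r > 0" by (rule pos)
    define e where "e = (1 / sqrt (h r r)) *\<^sub>R r"
    have ee: "h e e = 1" using rr unfolding e_def by (simp add: simps)
    have eb: "h e b = 0" "h b e = 0" if "b \<in> B" for b
      using residual_orthogonal[OF B(1), of b w] that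
      by (auto simp: e_def r_def[symmetric] simps commute[of b] span_base)
    have "e \<notin> B" using ee eb by force
    have "orthonormal (insert e B)"
      using B(1) ee eb \<open>e \<notin> B\<close> by (auto simp: orthonormal_def)
    moreover have "insert e B \<subseteq> W"
      using \<open>r \<in> W\<close> B assms by (auto simp: e_def subspace_scale)
    moreover have "card (insert e B) = Suc k"
      using \<open>e \<notin> B\<close> B by (simp add: orthonormal_def)
    ultimately show False using k(2)[of "Suc k"] by auto
  qed
  moreover have "span B \<subseteq> W" using B assms span_minimal by blast
  ultimately show ?thesis using B by (auto simp: orthonormal_basis_iff)
qed

lemma onb:
  assumes "subspace W"
  shows "orthonormal_basis h W (onb h W)"
  unfolding onb_def using ex_orthonormal_basis[OF assms] by (rule someI_ex)

text \<open>Expanding each \<open>b\<close> along \<open>C\<close> gives a double sum, and summing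
  over \<open>B\<close> first is Parseval for \<open>T c\<close> and \<open>c\<close>. Since
  \<open>onb\<close> picks an arbitrary basis, this is what allows Ricci traces to be computed in a
  basis adapted to a subspace.\<close>

lemma trace_basis_independent:
  assumes "linear T" "orthonormal_basis h UNIV B" "orthonormal_basis h UNIV C"
  shows "(\<Sum>b\<in>B. h (T b) b) = (\<Sum>c\<in>C. h (T c) c)"
proof -
  have B: "orthonormal B" "\<And>v. v \<in> span B" and C: "orthonormal C" "\<And>v. v \<in> span C"
    using assms by (auto simp: orthonormal_basis_iff)
  have "(\<Sum>b\<in>B. h (T b) b) = (\<Sum>b\<in>B. \<Sum>c\<in>C. h b c * h (T c) b)"
  proof (intro sum.cong refl)
    fix b
    have "T b = (\<Sum>c\<in>C. h b c *\<^sub>R T c)"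
      by (subst orthonormal_expand[OF C]) (simp add: linear_sum[OF assms(1)] linear_scale[OF assms(1)])
    then show "h (T b) b = (\<Sum>c\<in>C. h b c * h (T c) b)"
      by (simp add: sum_left simps)
  qed
  also have "\<dots> = (\<Sum>c\<in>C. \<Sum>b\<in>B. h (T c) b * h c b)"
    by (subst sum.swap) (simp only: commute[of _ "_ :: 'e"] mult.commute)
  also have "\<dots> = (\<Sum>c\<in>C. h (T c) c)"
    by (simp add: orthonormal_parseval[OF B])
  finally show ?thesis .
qed

section \<open>Orthogonal complements and projections\<close>

definition perp :: "'e set \<Rightarrow> 'e set" where
  "perp W = {v. \<forall>w\<in>W. h v w = 0}"

lemma subspace_perp: "subspace (perp W)"
  by (auto simp: perp_def subspace_def simps)

text \<open>Shaped like \<open>normal_part\<close>, so that the two coincide by unfolding when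
  \<open>W\<close> is the range of the differential.\<close>

definition perp_part :: "'e set \<Rightarrow> 'e \<Rightarrow> 'e" where
  "perp_part W v = (THE w. w \<in> perp W \<and> v - w \<in> W)"

text \<open>Two candidates differ by a vector lying in both \<open>W\<close> and
  \<open>perp W\<close>, hence orthogonal to itself.\<close>

lemma perp_part_eqI:
  assumes "subspace W" "w \<in> perp W" "v - w \<in> W"
  shows "perp_part W v = w"
  unfolding perp_part_def
proof (rule the_equality)
  fix w' assume w': "w' \<in> perp W \<and> v - w' \<in> W"
  then have "w' - w \<in> perp W" using assms subspace_perp subspace_diff by blast
  moreover have "w' - w \<in> W"
    using subspace_diff[OF assms(1,3), of "v - w'"] w' by simp
  ultimately have "h (w' - w) (w' - w) = 0" unfolding perp_def by blast
  then show "w' = w" by (simp only: eq_zero_iff) simp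
qed (use assms in blast)

lemma perp_part_formula:
  assumes "orthonormal_basis h W A"
  shows "perp_part W v = v - (\<Sum>a\<in>A. h v a *\<^sub>R a)"
proof (rule perp_part_eqI)
  have A: "orthonormal A" "W = span A" using assms by (auto simp: orthonormal_basis_iff)
  then show "subspace W" by simp
  show "v - (\<Sum>a\<in>A. h v a *\<^sub>R a) \<in> perp W"
    using residual_orthogonal[OF A(1)] A(2) by (simp add: perp_def)
  show "v - (v - (\<Sum>a\<in>A. h v a *\<^sub>R a)) \<in> W"
    by (simp add: A(2) span_base span_scale span_sum)
qed

lemma linear_perp_part:
  assumes "subspace W"
  shows "linear (perp_part W)"
  by (intro linearI)
    (simp_all add: perp_part_formula[OF onb[OF assms]] simps scaleR_add_left sum.distrib
      scaleR_right_diff_distrib scaleR_sum_right)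

lemma perp_part_in_perp:
  assumes "subspace W"
  shows "perp_part W v \<in> perp W"
proof -
  note B = orthonormal_basisD[OF onb[OF assms]]
  have "h (perp_part W v) w = 0" if "w \<in> W" for w
    unfolding perp_part_formula[OF onb[OF assms]]
    using that B(4) by (intro residual_orthogonal B(1)) simp
  then show ?thesis by (simp add: perp_def)
qed

lemma perp_part_id:
  assumes "subspace W" "v \<in> perp W"
  shows "perp_part W v = v"
  using assms by (intro perp_part_eqI) (auto simp: subspace_0)

lemma inner_perp_part:
  assumes "subspace W" "z \<in> perp W"
  shows "h (perp_part W v) z = h v z"
proof -
  have "h a z = 0" if "a \<in> onb h W" for a
    using that assms orthonormal_basisD(3)[OF onb[OF assms(1)]] commute[of a z]
    by (auto simp: perp_def)
  then show ?thesis
    by (simp add: perp_part_formula[OF onb[OF assms(1)]] simps sum_left)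
qed

text \<open>Every vector is its expansion along \<open>A\<close> plus its projection to
  \<open>perp W\<close>, so the union spans. With tangent and normal spaces for \<open>W\<close> and
  \<open>perp W\<close>, a full Ricci trace splits into a tangential and a normal sum.\<close>

lemma orthonormal_basis_Un:
  assumes A: "orthonormal_basis h W A" and B: "orthonormal_basis h (perp W) B"
  shows "orthonormal_basis h UNIV (A \<union> B)" and "A \<inter> B = {}"
proof -
  have AW: "A \<subseteq> W" and BW: "B \<subseteq> perp W" and W: "W = span A" and sp: "perp W = span B"
    using orthonormal_basisD[OF A] orthonormal_basisD[OF B] by auto
  have ab: "h b a = 0" "h a b = 0" if "a \<in> A" "b \<in> B" for a b
    using that AW BW commute[of a b] by (auto simp: perp_def)
  have oA: "orthonormal A" and oB: "orthonormal B"
    using orthonormal_basisD[OF A] orthonormal_basisD[OF B] by auto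
  show dj: "A \<inter> B = {}"
  proof (rule ccontr)
    assume "A \<inter> B \<noteq> {}"
    then obtain a where "a \<in> A" "a \<in> B" by blast
    then show False using ab[of a a] oA by (auto simp: orthonormal_def)
  qed
  have "v \<in> span (A \<union> B)" for v
  proof -
    have "perp_part W v \<in> span B"
      using perp_part_in_perp[of W v] W sp by simp
    moreover have "(\<Sum>a\<in>A. h v a *\<^sub>R a) \<in> span A"
      by (simp add: span_base span_scale span_sum)
    moreover have "v = (\<Sum>a\<in>A. h v a *\<^sub>R a) + perp_part W v"
      by (simp add: perp_part_formula[OF A])
    ultimately show ?thesis
      unfolding span_Un by blast
  qed
  moreover have "orthonormal (A \<union> B)"
    unfolding orthonormal_def
  proof (intro conjI ballI)
    show "finite (A \<union> B)" using oA oB by (simp add: orthonormal_def)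
    fix x y assume "x \<in> A \<union> B" "y \<in> A \<union> B"
    then show "h x y = (if x = y then 1 else 0)"
      using oA oB dj ab by (auto simp: orthonormal_def)
  qed
  ultimately show "orthonormal_basis h UNIV (A \<union> B)"
    by (auto simp: orthonormal_basis_iff)
qed

end

section \<open>Algebraic curvature tensors and their Ricci traces\<close>

locale curvature_form = inner_form h
  for h :: "'e::euclidean_space \<Rightarrow> 'e \<Rightarrow> real" +
  fixes R :: "'e \<Rightarrow> 'e \<Rightarrow> 'e \<Rightarrow> 'e"
  assumes linear_first: "linear (\<lambda>u. R u v w)"
    and antisym: "R v u w = - R u v w"
    and skew: "h (R u v w) z = - h w (R u v z)"
    and bianchi: "R u v w + R v w u + R w u v = 0"
begin

lemma self_zero: "R u u w = 0"
  using antisym[of u u w] by (simp add: eq_neg_iff_add_eq_0 flip: scaleR_2)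

lemma linear_second: "linear (\<lambda>v. R u v w)"
  using linear_compose_neg[OF linear_first[of u w]] by (simp add: antisym[of u])

text \<open>Skewness moves the third argument of \<open>R\<close> into a slot of \<open>h\<close>,
  where linearity is known.\<close>

lemma linear_third: "linear (R u v)"
proof (rule linearI)
  fix a b and r :: real
  show "R u v (a + b) = R u v a + R u v b" "R u v (r *\<^sub>R a) = r *\<^sub>R R u v a"
    by (rule eqI; simp add: simps skew)+
qed

text \<open>The octahedron argument: take the Bianchi identity for the four cyclic shifts of
  \<open>u v w z\<close> with signs +, +, -, -. The skew symmetries in the first and in the last
  pair cancel everything but twice the difference of the two sides.\<close>

lemma pair_symmetry: "h (R u v w) z = h (R w z u) v"
proof -
  have B: "h (R a b c) d + h (R b c a) d + h (R c a b) d = 0" for a b c d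
    using bianchi[of a b c] by (metis simps(1) simps(9))
  have S: "h (R a b c) d = - h (R a b d) c" for a b c d
    using skew[of a b c d] commute by metis
  have T: "h (R a b c) d = - h (R b a c) d" for a b c d
    by (subst antisym) (simp add: simps)
  show ?thesis
    using B[of u v w z] B[of v w z u] B[of w z u v] B[of z u v w]
      S[of u v w z] S[of v w u z] S[of w u v z] S[of v w z u] S[of w z v u] S[of z v w u]
      S[of w z u v] S[of z u w v] S[of u w z v] S[of z u v w] S[of u v z w] S[of v z u w]
      T[of w u v z] T[of z v w u] T[of u w z v] T[of v z u w]
    by (smt (verit) S T)
qed

definition ric :: "'e \<Rightarrow> 'e \<Rightarrow> real" where
  "ric u v = (\<Sum>e\<in>onb h UNIV. h (R e u v) e)"

lemma ric_eq:
  assumes "orthonormal_basis h UNIV B"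
  shows "ric u v = (\<Sum>e\<in>B. h (R e u v) e)"
  unfolding ric_def
  by (rule trace_basis_independent[OF linear_first onb[OF subspace_UNIV] assms])

text \<open>Used to identify the Einstein constant as the scalar curvature divided by the
  dimension.\<close>

lemma einstein_scalar:
  assumes "\<And>u v. ric u v = l * h u v"
  shows "(\<Sum>e\<in>onb h UNIV. ric e e) = l * real DIM('e)"
proof -
  have o: "orthonormal_basis h UNIV (onb h UNIV)" by (rule onb) simp
  have "(\<Sum>e\<in>onb h UNIV. ric e e) = (\<Sum>e\<in>onb h UNIV. l)"
    by (intro sum.cong) (simp_all add: assms orthonormal_basisD[OF o])
  then show ?thesis using orthonormal_basis_card[OF o] by simp
qed

lemma einstein_partial_ricci:
  assumes ric: "\<And>u v. ric u v = l * h u v"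
    and W: "subspace W" and v: "v \<in> perp W"
  shows "(\<Sum>e\<in>onb h W. perp_part W (R e v e)) =
    - (l *\<^sub>R v) + - (\<Sum>e\<in>onb h (perp W). perp_part W (R e v e))"
proof -
  let ?A = "onb h W" and ?B = "onb h (perp W)"
  note U = orthonormal_basis_Un[OF onb[OF W] onb[OF subspace_perp[of W]]]
  have fin: "finite ?A" "finite ?B"
    by (simp_all add: orthonormal_basisD(2)[OF onb[OF W]]
        orthonormal_basisD(2)[OF onb[OF subspace_perp[of W]]])
  have "(\<Sum>e\<in>?A \<union> ?B. R e v e) = - (l *\<^sub>R v)"
  proof (rule eqI)
    fix w
    \<comment> \<open>Skewness exchanges the last \<open>e\<close> with \<open>w\<close>, which
      turns the pairing into minus a Ricci trace.\<close>
    have "h (\<Sum>e\<in>?A \<union> ?B. R e v e) w = - (\<Sum>e\<in>?A \<union> ?B. h (R e v w) e)"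
      by (simp add: sum_left skew[of _ v _ w] commute[of _ "R _ v w"] sum_negf)
    also have "\<dots> = h (- (l *\<^sub>R v)) w"
      using ric[of v w] ric_eq[OF U(1), of v w] by (simp add: simps)
    finally show "h (\<Sum>e\<in>?A \<union> ?B. R e v e) w = h (- (l *\<^sub>R v)) w" .
  qed
  \<comment> \<open>The right-hand side is already normal, so the projection leaves it
    unchanged.\<close>
  then have "perp_part W (\<Sum>e\<in>?A \<union> ?B. R e v e) = - (l *\<^sub>R v)"
    using v W by (simp add: perp_part_id subspace_perp subspace_neg subspace_scale)
  then have "(\<Sum>e\<in>?A. perp_part W (R e v e)) + (\<Sum>e\<in>?B. perp_part W (R e v e)) = - (l *\<^sub>R v)"
    by (simp only: linear_add[OF linear_perp_part[OF W]] linear_sum[OF linear_perp_part[OF W]]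
        sum.union_disjoint[OF fin U(2)] o_def)
  then show ?thesis
    by (simp add: eq_diff_eq)
qed

lemma hypersurface_ricci_perp:
  assumes W: "subspace W" and v: "v \<in> perp W" and d: "DIM('e) = dim W + 1"
  shows "(\<Sum>e\<in>onb h (perp W). perp_part W (R e v e)) = 0"
proof -
  let ?A = "onb h W" and ?B = "onb h (perp W)"
  note oA = onb[OF W] and oB = onb[OF subspace_perp[of W]]
  note U = orthonormal_basis_Un[OF oA oB]
  have fin: "finite ?A" "finite ?B"
    by (simp_all add: orthonormal_basisD(2)[OF oA] orthonormal_basisD(2)[OF oB])
  have "card ?A + card ?B = DIM('e)"
    using orthonormal_basis_card[OF U(1)] card_Un_disjoint[OF fin U(2)] by simp
  then have "card ?B = 1" using d orthonormal_basis_card[OF oA] by simp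
  then obtain b where b: "?B = {b}" by (auto simp: card_1_singleton_iff)
  moreover have "v \<in> span ?B" using v orthonormal_basisD(4)[OF oB] by simp
  ultimately obtain c where "v = c *\<^sub>R b" by (auto simp: span_singleton)
  then have "R b v b = 0"
    using linear_scale[OF linear_second, of b c b b] self_zero[of b b] by simp
  moreover have "perp_part W 0 = 0"
    by (rule linear_0[OF linear_perp_part[OF W]])
  ultimately show ?thesis unfolding b by simp
qed

text \<open>On distinct vectors of an orthonormal basis the denominator of the sectional curvature
  is 1, so each such pair contributes \<open>k\<close>. Diagonal pairs vanish by antisymmetry,
  whence the factor \<open>DIM('e) - 1\<close>.\<close>

lemma constant_curvature_scalar:
  assumes k: "\<And>u v. independent {u, v} \<Longrightarrow> u \<noteq> v \<Longrightarrow>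
      h (R u v v) u / (h u u * h v v - (h u v)\<^sup>2) = k"
  shows "(\<Sum>e\<in>onb h UNIV. ric e e) = real DIM('e) * (real DIM('e) - 1) * k"
proof -
  let ?B = "onb h UNIV"
  have o: "orthonormal_basis h UNIV ?B" by (rule onb) simp
  then have on: "orthonormal ?B" and fin: "finite ?B"
    by (simp_all add: orthonormal_basisD)
  have *: "h (R u v v) u = (if u = v then 0 else k)" if "u \<in> ?B" "v \<in> ?B" for u v
  proof (cases "u = v")
    case False
    have "independent {u, v}"
      using independent_mono[OF orthonormal_independent[OF on]] that by simp
    then show ?thesis
      using k[OF _ False] False on that by (simp add: orthonormal_def)
  qed (simp add: self_zero simps)
  have "ric e e = (real DIM('e) - 1) * k" if "e \<in> ?B" for e
  proof -
    have "ric e e = (\<Sum>u\<in>?B - {e}. h (R u e e) u)"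
      unfolding ric_def sum.remove[OF fin that] by (simp add: self_zero simps)
    also have "\<dots> = (\<Sum>u\<in>?B - {e}. k)"
      using that by (intro sum.cong) (auto simp: *)
    also have "\<dots> = real (card ?B - 1) * k" using fin that by simp
    finally show ?thesis using orthonormal_basis_card[OF o] by (simp add: of_nat_diff DIM_positive Suc_leI)
  qed
  then show ?thesis using orthonormal_basis_card[OF o] by simp
qed

text \<open>By pair symmetry the form \<open>\<Sum>\<langle>R(e, v) w, e\<rangle>\<close> over a basis of \<open>W\<close> is symmetric in
  \<open>v\<close> and \<open>w\<close>, hence determined by its values on the diagonal, which are sectional curvatures.\<close>

lemma constant_curvature_partial_ricci:
  assumes k: "\<And>u v. independent {u, v} \<Longrightarrow> u \<noteq> v \<Longrightarrow>
      h (R u v v) u / (h u u * h v v - (h u v)\<^sup>2) = k"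
    and W: "subspace W" and v: "v \<in> perp W"
  shows "(\<Sum>e\<in>onb h W. perp_part W (R e v e)) = - ((real (dim W) * k) *\<^sub>R v)"
proof -
  let ?A = "onb h W"
  note oA = onb[OF W]
  have A: "\<And>e. e \<in> ?A \<Longrightarrow> h e e = 1" "?A \<subseteq> W"
    using orthonormal_basisD(3,5)[OF oA] by auto
  define b where "b x y = (\<Sum>e\<in>?A. h (R e x y) e)" for x y
  \<comment> \<open>A unit vector of \<open>W\<close> and a nonzero vector of \<open>perp W\<close>
    are orthogonal, hence independent, and the denominator of their sectional curvature is
    \<open>h x x\<close>.\<close>
  have sec: "h (R e x x) e = k * h x x" if "e \<in> ?A" "x \<in> perp W" for e x
  proof (cases "x = 0")
    case True then show ?thesis by (simp add: linear_0[OF linear_second] simps)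
  next
    case False
    have ex: "h e x = 0" using that A commute[of e x] by (auto simp: perp_def)
    have "e \<noteq> x" using ex A(1)[OF that(1)] by auto
    moreover have "independent {e, x}"
    proof -
      have "e \<notin> span {x}"
      proof
        assume "e \<in> span {x}"
        then obtain c where "e = c *\<^sub>R x" by (auto simp: span_singleton)
        then show False using ex A(1)[OF that(1)] by (auto simp: simps)
      qed
      then show ?thesis using False by (simp add: independent_insert)
    qed
    ultimately have "h (R e x x) e / (h e e * h x x - (h e x)\<^sup>2) = k" by (intro k)
    then show ?thesis
      using ex A(1)[OF that(1)] pos[OF False] by (simp add: field_simps)
  qed
  have bxx: "b x x = real (dim W) * k * h x x" if "x \<in> perp W" for x
    unfolding b_def using sec[OF _ that] orthonormal_basis_card[OF oA] by simp
  have sym: "b x y = b y x" for x y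
  proof -
    have "h (R e x y) e = h (R e y x) e" for e
    proof -
      have "h (R e x y) e = h (- R e y e) x"
        by (subst pair_symmetry) (simp only: antisym[of y e])
      then show ?thesis using skew[of e y x e] by (simp add: simps commute)
    qed
    then show ?thesis by (simp add: b_def)
  qed
  have add: "b (x + y) (x + y) = b x x + b x y + b y x + b y y" for x y
    by (simp add: b_def linear_add[OF linear_second] linear_add[OF linear_third] simps sum.distrib)
  \<comment> \<open>Polarisation: the diagonal values at \<open>x\<close>, \<open>y\<close> and
    \<open>x + y\<close> determine the symmetric form.\<close>
  have bxy: "b x y = real (dim W) * k * h x y" if "x \<in> perp W" "y \<in> perp W" for x y
    using bxx[of x] bxx[of y] bxx[of "x + y"] that add[of x y] sym[of x y]
      subspace_add[OF subspace_perp that]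
    by (simp add: simps commute[of y x] distrib_left)
  let ?s = "\<Sum>e\<in>?A. perp_part W (R e v e)"
  \<comment> \<open>The claim is \<open>q = 0\<close>. As \<open>q\<close> is itself normal, it is
    enough that its pairing with normal vectors vanishes, taken at \<open>q\<close>.\<close>
  define q where "q = ?s + (real (dim W) * k) *\<^sub>R v"
  have "q \<in> perp W"
    unfolding q_def by (intro subspace_add subspace_sum subspace_scale subspace_perp
        perp_part_in_perp W v)
  have "h ?s w = - b v w" if "w \<in> perp W" for w
    by (simp add: b_def sum_left inner_perp_part[OF W that] skew[of _ v _ w]
        commute[of _ "R _ v w"] sum_negf)
  then have "h q q = 0"
    using \<open>q \<in> perp W\<close> bxy[OF v] by (simp add: q_def simps(1,5))
  then show ?thesis by (simp add: q_def eq_zero_iff eq_neg_iff_add_eq_0)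
qed

end

section \<open>The Levi-Civita connection of a metric on an open set\<close>

lemma frechet_derivative_cong_open:
  assumes "open S" "x \<in> S" "\<And>y. y \<in> S \<Longrightarrow> f y = g y"
  shows "frechet_derivative f (at x) = frechet_derivative g (at x)"
proof -
  have "(f has_derivative F) (at x) \<longleftrightarrow> (g has_derivative F) (at x)" for F
    using has_derivative_transform_within_open[OF _ assms(1,2), of f F UNIV g]
      has_derivative_transform_within_open[OF _ assms(1,2), of g F UNIV f] assms(3) by auto
  then show ?thesis unfolding frechet_derivative_def by simp
qed

lemma frechet_derivative_eqI:
  assumes "(f has_derivative F) (at x)"
  shows "frechet_derivative f (at x) = F"
  using frechet_derivative_at[OF assms] by simp

lemma differentiable_cong_open:
  assumes "open S" "x \<in> S" "\<And>y. y \<in> S \<Longrightarrow> f y = g y" "f differentiable (at x)"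
  shows "g differentiable (at x)"
  using assms has_derivative_transform_within_open[OF _ assms(1,2), of f _ UNIV g]
  unfolding differentiable_def by blast

text \<open>The mean value theorem is applied to \<open>s \<mapsto> f (x + s u + t v) - f (x + s u)\<close>; only
  differentiability at \<open>x\<close> of the derivative in direction \<open>u\<close> is needed.\<close>

lemma second_difference_tendsto:
  fixes f :: "'x::real_normed_vector \<Rightarrow> real"
  assumes S: "open S" "x \<in> S" and f: "\<And>y. y \<in> S \<Longrightarrow> f differentiable (at y)"
    and F: "((\<lambda>y. frechet_derivative f (at y) u) has_derivative L) (at x)"
  shows "((\<lambda>t. (f (x + t *\<^sub>R u + t *\<^sub>R v) - f (x + t *\<^sub>R u) - f (x + t *\<^sub>R v) + f x) / t\<^sup>2)
    \<longlongrightarrow> L v) (at_right 0)"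
proof (rule tendstoI)
  fix e :: real assume "e > 0"
  let ?F = "\<lambda>y. frechet_derivative f (at y) u"
  let ?c = "norm u + norm v + 1"
  \<comment> \<open>Two first-order errors, each at most \<open>e' * (t * ?c)\<close>, must add up
    to strictly less than \<open>t * e\<close>; the 4 leaves room for this. The summand 1 in
    \<open>?c\<close> keeps it positive when \<open>u\<close> and \<open>v\<close> are both
    zero.\<close>
  define e' where "e' = e / (4 * ?c)"
  have c: "?c > 0" by (smt (verit) norm_ge_zero)
  then have e': "e' > 0" using \<open>e > 0\<close> by (simp add: e'_def)
  have "e / (4 * r) * (2 * r) = e / 2" if "r > 0" for r
    using that by (simp add: field_simps)
  then have "e' * (2 * ?c) = e / 2" using c unfolding e'_def by blast
  then have e'c: "e' * (2 * ?c) < e" using \<open>e > 0\<close> by linarith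
  have L: "bounded_linear L" using F by (rule has_derivative_bounded_linear)
  obtain d1 where d1: "d1 > 0"
    "\<And>y. norm (y - x) < d1 \<Longrightarrow> norm (?F y - ?F x - L (y - x)) \<le> e' * norm (y - x)"
    using F e' unfolding has_derivative_at_alt by blast
  obtain d2 where d2: "d2 > 0" "ball x d2 \<subseteq> S" using S open_contains_ball by blast
  define d where "d = min d1 d2"
  have d: "d > 0" using d1 d2 by (simp add: d_def)
  have main: "\<bar>(f (x + t *\<^sub>R u + t *\<^sub>R v) - f (x + t *\<^sub>R u) - f (x + t *\<^sub>R v) + f x) / t\<^sup>2 - L v\<bar> < e"
    if t: "0 < t" "t < d / ?c" for t
  proof -
    have tc: "t * ?c < d" using t c by (simp add: field_simps)
    have near: "norm (s *\<^sub>R u + r *\<^sub>R v) \<le> t * ?c" "norm (s *\<^sub>R u + r *\<^sub>R v) < d"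
      if "0 \<le> s" "s \<le> t" "0 \<le> r" "r \<le> t" for s r
    proof -
      have "norm (s *\<^sub>R u + r *\<^sub>R v) \<le> s * norm u + r * norm v"
        using norm_triangle_ineq[of "s *\<^sub>R u" "r *\<^sub>R v"] that by simp
      also have "\<dots> \<le> t * norm u + t * norm v"
        using that by (intro add_mono mult_right_mono) auto
      also have "\<dots> \<le> t * ?c" using t by (simp add: algebra_simps)
      finally show "norm (s *\<^sub>R u + r *\<^sub>R v) \<le> t * ?c" .
      then show "norm (s *\<^sub>R u + r *\<^sub>R v) < d" using tc by linarith
    qed
    have D: "((\<lambda>s. f (x + s *\<^sub>R u + r *\<^sub>R v)) has_real_derivative ?F (x + s *\<^sub>R u + r *\<^sub>R v)) (at s)"
      if "0 \<le> s" "s \<le> t" "0 \<le> r" "r \<le> t" for s r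
    proof -
      let ?y = "x + s *\<^sub>R u + r *\<^sub>R v"
      have "?y \<in> S" using near(2)[OF that] d2 by (auto simp: d_def dist_norm subset_iff add.assoc norm_minus_commute)
      then have fd: "(f has_derivative frechet_derivative f (at ?y)) (at ?y)"
        using f frechet_derivative_works by blast
      have "((\<lambda>s. x + s *\<^sub>R u + r *\<^sub>R v) has_derivative (\<lambda>h. h *\<^sub>R u)) (at s)"
        by (auto intro!: derivative_eq_intros)
      from has_derivative_compose[OF this fd]
      have "((\<lambda>s. f (x + s *\<^sub>R u + r *\<^sub>R v)) has_derivative (\<lambda>h. h * ?F ?y)) (at s)"
        using linear_scale[OF has_derivative_linear[OF fd]] by simp
      then show ?thesis by (simp add: has_field_derivative_def mult_commute_abs)
    qed
    let ?p = "\<lambda>s. f (x + s *\<^sub>R u + t *\<^sub>R v) - f (x + s *\<^sub>R u)"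
    have "(?p has_real_derivative ?F (x + s *\<^sub>R u + t *\<^sub>R v) - ?F (x + s *\<^sub>R u)) (at s)"
      if "0 \<le> s" "s \<le> t" for s
      using DERIV_diff[OF D[OF that, of t] D[OF that, of 0]] t by simp
    from MVT2[OF t(1) this]
    obtain z where z: "0 < z" "z < t"
      "?p t - ?p 0 = (t - 0) * (?F (x + z *\<^sub>R u + t *\<^sub>R v) - ?F (x + z *\<^sub>R u))" by blast
    let ?a = "z *\<^sub>R u + t *\<^sub>R v" and ?b = "z *\<^sub>R u"
    have na: "norm ?a \<le> t * ?c" "norm ?a < d" using near[of z t] z t by auto
    have nb: "norm ?b \<le> t * ?c" "norm ?b < d" using near[of z 0] z t by auto
    \<comment> \<open>Both points are close to \<open>x\<close>, so \<open>L\<close> approximates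
      the increments of \<open>?F\<close> there; in the difference of the two only
      \<open>L (t *\<^sub>R v)\<close> remains.\<close>
    have "norm (?F (x + ?a) - ?F x - L ?a) \<le> e' * norm ?a"
      using d1(2)[of "x + ?a"] na by (simp add: d_def)
    moreover have "norm (?F (x + ?b) - ?F x - L ?b) \<le> e' * norm ?b"
      using d1(2)[of "x + ?b"] nb by (simp add: d_def)
    moreover have "e' * norm ?a \<le> e' * (t * ?c)" "e' * norm ?b \<le> e' * (t * ?c)"
      using na nb e' by (auto intro!: mult_left_mono)
    moreover have "L ?a - L ?b = t * L v"
      using L by (simp add: bounded_linear.linear linear_add linear_scale)
    ultimately have "\<bar>?F (x + ?a) - ?F (x + ?b) - t * L v\<bar> \<le> e' * (t * ?c) + e' * (t * ?c)"
      unfolding real_norm_def by linarith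
    also have "\<dots> = t * (e' * (2 * ?c))" by (simp add: algebra_simps)
    also have "\<dots> < t * e" using e'c t by (intro mult_strict_left_mono)
    finally have lt: "\<bar>?F (x + ?a) - ?F (x + ?b) - t * L v\<bar> < t * e" .
    have eq: "f (x + t *\<^sub>R u + t *\<^sub>R v) - f (x + t *\<^sub>R u) - f (x + t *\<^sub>R v) + f x =
        t * (?F (x + ?a) - ?F (x + ?b))"
      using z(3) by (simp add: add.assoc)
    have "(f (x + t *\<^sub>R u + t *\<^sub>R v) - f (x + t *\<^sub>R u) - f (x + t *\<^sub>R v) + f x) / t\<^sup>2 - L v =
        (?F (x + ?a) - ?F (x + ?b) - t * L v) / t"
      unfolding eq using t by (simp add: field_simps power2_eq_square)
    then show ?thesis using lt t by (simp add: abs_divide divide_less_eq mult.commute)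
  qed
  show "\<forall>\<^sub>F t in at_right 0. dist ((f (x + t *\<^sub>R u + t *\<^sub>R v) - f (x + t *\<^sub>R u) - f (x + t *\<^sub>R v) + f x) / t\<^sup>2)
      (L v) < e"
    unfolding eventually_at_right_field
    using main d c by (intro exI[of _ "d / ?c"]) (auto simp: dist_real_def)
qed

text \<open>The second difference quotient is symmetric in \<open>u\<close> and \<open>v\<close>,
  and each mixed derivative is its limit.\<close>

lemma second_derivative_symmetric:
  fixes f :: "'x::real_normed_vector \<Rightarrow> real"
  assumes "open S" "x \<in> S" "\<And>y. y \<in> S \<Longrightarrow> f differentiable (at y)"
    and u: "(\<lambda>y. frechet_derivative f (at y) u) differentiable (at x)"
    and v: "(\<lambda>y. frechet_derivative f (at y) v) differentiable (at x)"
  shows "frechet_derivative (\<lambda>y. frechet_derivative f (at y) u) (at x) v =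
    frechet_derivative (\<lambda>y. frechet_derivative f (at y) v) (at x) u"
proof (rule tendsto_unique[OF trivial_limit_at_right_real])
  show "((\<lambda>t. (f (x + t *\<^sub>R u + t *\<^sub>R v) - f (x + t *\<^sub>R u) - f (x + t *\<^sub>R v) + f x) / t\<^sup>2)
    \<longlongrightarrow> frechet_derivative (\<lambda>y. frechet_derivative f (at y) u) (at x) v) (at_right 0)"
    by (rule second_difference_tendsto[OF assms(1-3) u[unfolded frechet_derivative_works]])
  have "((\<lambda>t. (f (x + t *\<^sub>R v + t *\<^sub>R u) - f (x + t *\<^sub>R v) - f (x + t *\<^sub>R u) + f x) / t\<^sup>2)
    \<longlongrightarrow> frechet_derivative (\<lambda>y. frechet_derivative f (at y) v) (at x) u) (at_right 0)"
    by (rule second_difference_tendsto[OF assms(1-3) v[unfolded frechet_derivative_works]])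
  then show "((\<lambda>t. (f (x + t *\<^sub>R u + t *\<^sub>R v) - f (x + t *\<^sub>R u) - f (x + t *\<^sub>R v) + f x) / t\<^sup>2)
    \<longlongrightarrow> frechet_derivative (\<lambda>y. frechet_derivative f (at y) v) (at x) u) (at_right 0)"
    by (simp add: algebra_simps)
qed

section \<open>The Koszul formula and the Christoffel form\<close>

locale local_metric =
  fixes S :: "'e::euclidean_space set" and g :: "'e \<Rightarrow> 'e \<Rightarrow> 'e \<Rightarrow> real"
  assumes open_domain: "open S"
    and inner_product: "x \<in> S \<Longrightarrow> inner_product (g x)"
    and differentiable: "x \<in> S \<Longrightarrow> (\<lambda>y. g y u v) differentiable (at x)"
    and differentiable2:
      "x \<in> S \<Longrightarrow> (\<lambda>y. frechet_derivative (\<lambda>y. g y u v) (at y) w) differentiable (at x)"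
begin

lemma inner_form: "x \<in> S \<Longrightarrow> inner_form (g x)"
  by unfold_locales (rule inner_product)

lemmas g_simps = inner_form.simps[OF inner_form]
lemmas g_commute = inner_form.commute[OF inner_form]

definition Dg :: "'e \<Rightarrow> 'e \<Rightarrow> 'e \<Rightarrow> 'e \<Rightarrow> real" where
  "Dg x w u v = frechet_derivative (\<lambda>y. g y u v) (at x) w"

lemma has_derivative_g: "x \<in> S \<Longrightarrow> ((\<lambda>y. g y u v) has_derivative (\<lambda>w. Dg x w u v)) (at x)"
  using differentiable unfolding Dg_def frechet_derivative_works by simp

lemma Dg_linear: "x \<in> S \<Longrightarrow> linear (\<lambda>w. Dg x w u v)"
  by (rule has_derivative_linear[OF has_derivative_g])

lemma Dg_sym: "x \<in> S \<Longrightarrow> Dg x w u v = Dg x w v u"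
  unfolding Dg_def
  by (subst frechet_derivative_cong_open[OF open_domain, where g = "\<lambda>y. g y v u"])
    (auto simp: g_commute)

text \<open>Differentiates the linearity of \<open>g y\<close> in its second argument, an identity
  valid at all \<open>y\<close> in \<open>S\<close>.\<close>

lemma Dg_linear_right:
  assumes "x \<in> S"
  shows "linear (\<lambda>v. Dg x w u v)"
proof (rule linearI)
  fix a b and r :: real
  have "frechet_derivative (\<lambda>y. g y u (a + b)) (at x) = (\<lambda>w. Dg x w u a + Dg x w u b)"
    by (subst frechet_derivative_cong_open[OF open_domain assms, where g = "\<lambda>y. g y u a + g y u b"])
      (auto simp: g_simps intro!: frechet_derivative_eqI has_derivative_add has_derivative_g assms)
  then show "Dg x w u (a + b) = Dg x w u a + Dg x w u b" by (simp add: Dg_def)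
  have "frechet_derivative (\<lambda>y. g y u (r *\<^sub>R a)) (at x) = (\<lambda>w. r * Dg x w u a)"
    by (subst frechet_derivative_cong_open[OF open_domain assms, where g = "\<lambda>y. r * g y u a"])
      (auto simp: g_simps intro!: frechet_derivative_eqI has_derivative_mult_right has_derivative_g assms)
  then show "Dg x w u (r *\<^sub>R a) = r *\<^sub>R Dg x w u a" by (simp add: Dg_def)
qed

lemma Dg_linear_left:
  assumes "x \<in> S"
  shows "linear (\<lambda>u. Dg x w u v)"
  using Dg_linear_right[OF assms, of w v] by (subst Dg_sym[OF assms])

text \<open>The Koszul formula for fields with constant components, whose Lie brackets vanish: the
  value that the pairing of \<Gamma>(u, v) with w must take.\<close>

definition koszul :: "'e \<Rightarrow> 'e \<Rightarrow> 'e \<Rightarrow> 'e \<Rightarrow> real" where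
  "koszul x u v w = (Dg x u v w + Dg x v u w - Dg x w u v) / 2"

lemma koszul_linear: "x \<in> S \<Longrightarrow> linear (koszul x u v)"
  unfolding koszul_def
  by (intro linearI) (simp_all add: linear_add[OF Dg_linear] linear_add[OF Dg_linear_right]
      linear_cmul[OF Dg_linear] linear_cmul[OF Dg_linear_right] field_simps)

lemma koszul_add_left: "x \<in> S \<Longrightarrow> koszul x (a + b) v w = koszul x a v w + koszul x b v w"
  and koszul_scale_left: "x \<in> S \<Longrightarrow> koszul x (r *\<^sub>R a) v w = r * koszul x a v w"
  unfolding koszul_def
  by (simp_all add: linear_add[OF Dg_linear] linear_add[OF Dg_linear_right] linear_add[OF Dg_linear_left]
      linear_cmul[OF Dg_linear] linear_cmul[OF Dg_linear_right] linear_cmul[OF Dg_linear_left] field_simps)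

lemma koszul_sym: "x \<in> S \<Longrightarrow> koszul x u v w = koszul x v u w"
  unfolding koszul_def by (simp add: Dg_sym[of x w u v])

text \<open>The predicate under \<open>THE\<close> in \<open>christoffel\<close>, for a general
  metric \<open>g\<close>; the two agree by unfolding.\<close>

definition connection :: "'e \<Rightarrow> ('e \<Rightarrow> 'e \<Rightarrow> 'e) \<Rightarrow> bool" where
  "connection x \<Gamma> \<longleftrightarrow> bilinear \<Gamma> \<and> (\<forall>u v. \<Gamma> u v = \<Gamma> v u) \<and>
     (\<forall>w u v. Dg x w u v = g x (\<Gamma> w u) v + g x u (\<Gamma> w v))"

text \<open>In the Koszul combination of three instances of compatibility, symmetry of \<Gamma>
  cancels all terms except two copies of the pairing of \<Gamma>(u, v) with w.\<close>

lemma connection_koszul: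
  assumes x: "x \<in> S" and c: "connection x \<Gamma>"
  shows "g x (\<Gamma> u v) w = koszul x u v w"
proof -
  have D: "Dg x w u v = g x (\<Gamma> w u) v + g x u (\<Gamma> w v)" and s: "\<Gamma> u v = \<Gamma> v u" for w u v
    using c unfolding connection_def by blast+
  show ?thesis
    unfolding koszul_def D
    using g_commute[OF x, of v "\<Gamma> u w"] g_commute[OF x, of u "\<Gamma> v w"] g_commute[OF x, of u "\<Gamma> w v"]
      s[of u v] s[of u w] s[of v w] by simp
qed

text \<open>The witness is the Riesz representative of the linear form \<open>koszul x u v\<close>,
  written in an orthonormal basis of \<open>g x\<close>.\<close>

lemma ex_connection:
  assumes x: "x \<in> S"
  shows "\<exists>\<Gamma>. connection x \<Gamma>"
proof -
  interpret inner_form "g x" by (rule inner_form[OF x])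
  have B: "orthonormal_basis (g x) UNIV (onb (g x) UNIV)" by (rule onb) simp
  define \<Gamma> where "\<Gamma> u v = (\<Sum>e\<in>onb (g x) UNIV. koszul x u v e *\<^sub>R e)" for u v
  have \<Gamma>: "g x (\<Gamma> u v) w = koszul x u v w" for u v w
  proof -
    have "koszul x u v w = koszul x u v (\<Sum>e\<in>onb (g x) UNIV. g x w e *\<^sub>R e)"
      using orthonormal_expand[OF orthonormal_basisD(1)[OF B], of w] orthonormal_basisD(4)[OF B] by simp
    also have "\<dots> = (\<Sum>e\<in>onb (g x) UNIV. g x w e * koszul x u v e)"
      by (simp add: linear_sum[OF koszul_linear[OF x]] linear_cmul[OF koszul_linear[OF x]] o_def)
    finally show ?thesis by (simp add: \<Gamma>_def sum_left simps commute[of w] mult.commute)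
  qed
  have "linear (\<Gamma> u)" "linear (\<lambda>u. \<Gamma> u v)" for u v
    by (intro linearI eqI; simp add: \<Gamma> simps koszul_add_left koszul_scale_left
        koszul_add_left[of x _ _ u] koszul_sym[of x u] x)+
  moreover have "\<Gamma> u v = \<Gamma> v u" for u v
    by (intro eqI) (simp add: \<Gamma> koszul_sym[OF x, of u v])
  moreover have "Dg x w u v = g x (\<Gamma> w u) v + g x u (\<Gamma> w v)" for w u v
    by (subst commute[of u]) (simp add: \<Gamma> koszul_def Dg_sym[OF x, of w v u] Dg_sym[OF x, of v u w]
        Dg_sym[OF x, of u v w] field_simps)
  ultimately show ?thesis unfolding connection_def bilinear_def by blast
qed

definition \<Gamma> :: "'e \<Rightarrow> 'e \<Rightarrow> 'e \<Rightarrow> 'e" where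
  "\<Gamma> x = (THE c. connection x c)"

lemma connection_\<Gamma>:
  assumes x: "x \<in> S"
  shows "connection x (\<Gamma> x)"
proof -
  interpret inner_form "g x" by (rule inner_form[OF x])
  obtain c where c: "connection x c" using ex_connection[OF x] by blast
  have "c' = c" if "connection x c'" for c'
    by (intro ext eqI) (simp add: connection_koszul[OF x] c that)
  with c show ?thesis unfolding \<Gamma>_def by (rule theI)
qed

lemma \<Gamma>_sym: "x \<in> S \<Longrightarrow> \<Gamma> x u v = \<Gamma> x v u"
  and \<Gamma>_compat: "x \<in> S \<Longrightarrow> Dg x w u v = g x (\<Gamma> x w u) v + g x u (\<Gamma> x w v)"
  and \<Gamma>_bilinear: "x \<in> S \<Longrightarrow> bilinear (\<Gamma> x)"
  using connection_\<Gamma> unfolding connection_def by blast+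

lemma \<Gamma>_koszul: "x \<in> S \<Longrightarrow> g x (\<Gamma> x u v) w = koszul x u v w"
  by (rule connection_koszul[OF _ connection_\<Gamma>])

lemma g_expand:
  assumes "x \<in> S"
  shows "g x y v = (\<Sum>c\<in>Basis. (y \<bullet> c) * g x c v)"
proof -
  interpret inner_form "g x" by (rule inner_form[OF assms])
  have "g x y v = g x (\<Sum>c\<in>Basis. (y \<bullet> c) *\<^sub>R c) v" by (simp add: euclidean_representation)
  then show ?thesis by (simp only: sum_left simps real_scaleR_def)
qed

text \<open>The vector \<open>\<Gamma> x u v\<close> solves a linear system with coefficients \<open>g x\<close>. The map \<open>(x, y) \<mapsto> (x, g x y)\<close>
  is injective with invertible derivative, so its inverse is differentiable.\<close>

lemma \<Gamma>_differentiable: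
  assumes x: "x \<in> S"
  shows "(\<lambda>y. \<Gamma> y u v) differentiable (at x)"
proof -
  let ?T = "S \<times> (UNIV :: 'e set)"
  \<comment> \<open>The second component lists the values \<open>g (fst p) (snd p) b\<close> over
    the standard basis; in coordinates its differentiability in both variables is visible.\<close>
  define F where "F p = (fst p, \<Sum>b\<in>Basis. (\<Sum>c\<in>Basis. (snd p \<bullet> c) * g (fst p) c b) *\<^sub>R b)"
    for p :: "'e \<times> 'e"
  define F' where "F' p d = (fst d, \<Sum>b\<in>Basis. (\<Sum>c\<in>Basis. (snd p \<bullet> c) * Dg (fst p) (fst d) c b +
      (snd d \<bullet> c) * g (fst p) c b) *\<^sub>R b)"
    for p d :: "'e \<times> 'e"
  have dF: "(F has_derivative F' p) (at p)" if "p \<in> ?T" for p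
  proof -
    have "((\<lambda>p. g (fst p) c b) has_derivative (\<lambda>d. Dg (fst p) (fst d) c b)) (at p)" for c b
      using that by (intro has_derivative_compose[OF has_derivative_fst has_derivative_g])
        (auto intro: derivative_eq_intros)
    note [derivative_intros] = this
    show ?thesis unfolding F_def[abs_def] F'_def[abs_def]
      by (auto intro!: derivative_eq_intros)
  qed
  have openT: "open ?T" by (simp add: open_Times open_domain)
  have contF: "continuous_on ?T F"
    using dF has_derivative_at_withinI
    by (intro differentiable_imp_continuous_on) (unfold differentiable_on_def differentiable_def, blast)
  have inj: "a = b" if "y \<in> S" "(\<Sum>b\<in>Basis. (\<Sum>c\<in>Basis. (a \<bullet> c) * g y c b) *\<^sub>R b) =
      (\<Sum>d\<in>Basis. (\<Sum>c\<in>Basis. (b \<bullet> c) * g y c d) *\<^sub>R d)" for y a b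
  proof (rule inner_form.eqI[OF inner_form[OF that(1)]])
    fix w
    have ab: "(\<Sum>b\<in>Basis. g y a b *\<^sub>R b) = (\<Sum>d\<in>Basis. g y b d *\<^sub>R d)"
      using that by (simp add: g_expand[OF that(1), of a] g_expand[OF that(1), of b])
    have "g y d a = g y d b" if "d \<in> Basis" for d
      using arg_cong[OF ab, of "\<lambda>v. v \<bullet> d"] that g_commute[OF \<open>y \<in> S\<close>, of d] by simp
    then have "g y w a = g y w b"
      by (simp add: g_expand[OF that(1), of w])
    then show "g y a w = g y b w"
      using g_commute[OF that(1), of w] by simp
  qed
  have injF: "inj_on F ?T"
  proof (rule inj_onI)
    fix p q assume "p \<in> ?T" "q \<in> ?T" "F p = F q"
    then have "fst p = fst q" "fst q \<in> S"
      "(\<Sum>b\<in>Basis. (\<Sum>c\<in>Basis. (snd p \<bullet> c) * g (fst q) c b) *\<^sub>R b) =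
        (\<Sum>b\<in>Basis. (\<Sum>c\<in>Basis. (snd q \<bullet> c) * g (fst q) c b) *\<^sub>R b)"
      unfolding F_def by auto
    then show "p = q" using inj[of "fst q" "snd p" "snd q"] by (simp add: prod_eq_iff)
  qed
  define H where "H = inv_into ?T F"
  have HF: "H (F p) = p" if "p \<in> ?T" for p
    unfolding H_def by (rule inv_into_f_f[OF injF that])
  let ?p = "(x, \<Gamma> x u v)"
  define A where "A y = (\<Sum>b\<in>Basis. (\<Sum>c\<in>Basis. (y \<bullet> c) * g x c b) *\<^sub>R b)" for y
  have linA: "linear A" unfolding A_def
    by (intro linearI) (simp_all add: inner_add_left distrib_right sum.distrib scaleR_add_left
        sum_distrib_left scaleR_sum_right mult.assoc)
  have "inj A" using inj[OF x] unfolding A_def by (intro injI)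
  then obtain C where C: "linear C" "A \<circ> C = id"
    using linear_injective_imp_surjective[OF linA] linear_surjective_right_inverse[OF linA] by blast
  define E where "E dx = (\<Sum>b\<in>Basis. (\<Sum>c\<in>Basis. (\<Gamma> x u v \<bullet> c) * Dg x dx c b) *\<^sub>R b)" for dx
  \<comment> \<open>The derivative of \<open>F\<close> at \<open>?p\<close> is block triangular with
    the identity and \<open>A\<close> on the diagonal; back substitution gives this right
    inverse.\<close>
  define H' where "H' d = (fst d, C (snd d - E (fst d)))" for d :: "'e \<times> 'e"
  have F'p: "F' ?p d = (fst d, E (fst d) + A (snd d))" for d
    by (simp add: F'_def E_def A_def sum.distrib scaleR_add_left)
  have "A (C z) = z" for z using C(2) by (metis comp_apply id_apply)
  then have "F' ?p \<circ> H' = id"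
    by (auto simp: fun_eq_iff F'p H'_def)
  from has_derivative_inverse_strong[OF openT _ contF HF dF this]
  have dH: "(H has_derivative H') (at (F ?p))" using x by simp
  \<comment> \<open>Along the graph of \<Gamma> the map \<open>F\<close> is explicit by the Koszul
    formula, so applying \<open>H\<close> to that explicit map recovers \<Gamma>.\<close>
  have FG: "F (y, \<Gamma> y u v) = (y, \<Sum>b\<in>Basis. koszul y u v b *\<^sub>R b)" if "y \<in> S" for y
    by (simp add: F_def g_expand[OF that, symmetric] \<Gamma>_koszul[OF that])
  have dk: "(\<lambda>y. koszul y u v b) differentiable (at x)" for b
    unfolding koszul_def Dg_def using differentiable2[OF x] by (intro derivative_intros) auto
  have "(\<lambda>y. (y, \<Sum>b\<in>Basis. koszul y u v b *\<^sub>R b)) differentiable (at x)"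
    using dk by (intro differentiable_Pair differentiable_ident differentiable_sum
        differentiable_scaleR differentiable_const) auto
  then obtain K where "((\<lambda>y. (y, \<Sum>b\<in>Basis. koszul y u v b *\<^sub>R b)) has_derivative K) (at x)"
    unfolding differentiable_def by blast
  from has_derivative_snd[OF has_derivative_compose[OF this dH[unfolded FG[OF x]]]]
  have "(\<lambda>y. snd (H (y, \<Sum>b\<in>Basis. koszul y u v b *\<^sub>R b))) differentiable (at x)"
    unfolding differentiable_def by blast
  then show ?thesis
    by (rule differentiable_cong_open[OF open_domain x, rotated])
      (metis FG HF SigmaI UNIV_I snd_conv)
qed

section \<open>The derivative of the Christoffel form and the curvature\<close>

definition D\<Gamma> :: "'e \<Rightarrow> 'e \<Rightarrow> 'e \<Rightarrow> 'e \<Rightarrow> 'e" where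
  "D\<Gamma> x w u v = frechet_derivative (\<lambda>y. \<Gamma> y u v) (at x) w"

lemma has_derivative_\<Gamma>:
  "x \<in> S \<Longrightarrow> ((\<lambda>y. \<Gamma> y u v) has_derivative (\<lambda>w. D\<Gamma> x w u v)) (at x)"
  using \<Gamma>_differentiable unfolding D\<Gamma>_def frechet_derivative_works by simp

lemma D\<Gamma>_linear: "x \<in> S \<Longrightarrow> linear (\<lambda>w. D\<Gamma> x w u v)"
  by (rule has_derivative_linear[OF has_derivative_\<Gamma>])

lemma D\<Gamma>_sym: "x \<in> S \<Longrightarrow> D\<Gamma> x w u v = D\<Gamma> x w v u"
  unfolding D\<Gamma>_def
  by (subst frechet_derivative_cong_open[OF open_domain, where g = "\<lambda>y. \<Gamma> y v u"])
    (auto simp: \<Gamma>_sym)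

lemma D\<Gamma>_linear_left:
  assumes "x \<in> S"
  shows "linear (\<lambda>u. D\<Gamma> x w u v)"
proof (rule linearI)
  fix a b and r :: real
  have "frechet_derivative (\<lambda>y. \<Gamma> y (a + b) v) (at x) = (\<lambda>w. D\<Gamma> x w a v + D\<Gamma> x w b v)"
    by (subst frechet_derivative_cong_open[OF open_domain assms, where g = "\<lambda>y. \<Gamma> y a v + \<Gamma> y b v"])
      (auto simp: bilinear_ladd[OF \<Gamma>_bilinear] intro!: frechet_derivative_eqI has_derivative_add
        has_derivative_\<Gamma> assms)
  then show "D\<Gamma> x w (a + b) v = D\<Gamma> x w a v + D\<Gamma> x w b v" by (simp add: D\<Gamma>_def)
  have "frechet_derivative (\<lambda>y. \<Gamma> y (r *\<^sub>R a) v) (at x) = (\<lambda>w. r *\<^sub>R D\<Gamma> x w a v)"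
    by (subst frechet_derivative_cong_open[OF open_domain assms, where g = "\<lambda>y. r *\<^sub>R \<Gamma> y a v"])
      (auto simp: bilinear_lmul[OF \<Gamma>_bilinear] intro!: frechet_derivative_eqI has_derivative_scaleR_right
        has_derivative_\<Gamma> assms)
  then show "D\<Gamma> x w (r *\<^sub>R a) v = r *\<^sub>R D\<Gamma> x w a v" by (simp add: D\<Gamma>_def)
qed

text \<open>A product rule: expanding the field in the standard basis reduces it to products of real
  functions.\<close>

lemma has_derivative_g_field:
  assumes x: "x \<in> S" and Y: "(Y has_derivative Y') (at x)"
  shows "((\<lambda>y. g y (Y y) z) has_derivative (\<lambda>w. Dg x w (Y x) z + g x (Y' w) z)) (at x)"
proof -
  have "((\<lambda>y. \<Sum>c\<in>Basis. (Y y \<bullet> c) * g y c z) has_derivative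
      (\<lambda>w. \<Sum>c\<in>Basis. (Y x \<bullet> c) * Dg x w c z + (Y' w \<bullet> c) * g x c z)) (at x)"
    by (intro has_derivative_sum has_derivative_mult has_derivative_g[OF x] has_derivative_inner_left Y)
  also have "(\<lambda>w. \<Sum>c\<in>Basis. (Y x \<bullet> c) * Dg x w c z + (Y' w \<bullet> c) * g x c z) =
      (\<lambda>w. Dg x w (Y x) z + g x (Y' w) z)"
  proof
    fix w
    have "Dg x w (Y x) z = Dg x w (\<Sum>c\<in>Basis. (Y x \<bullet> c) *\<^sub>R c) z"
      by (simp add: euclidean_representation)
    also have "\<dots> = (\<Sum>c\<in>Basis. (Y x \<bullet> c) * Dg x w c z)"
      by (simp only: linear_sum[OF Dg_linear_left[OF x]] linear_cmul[OF Dg_linear_left[OF x]] o_def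
          real_scaleR_def)
    finally show "(\<Sum>c\<in>Basis. (Y x \<bullet> c) * Dg x w c z + (Y' w \<bullet> c) * g x c z) =
        Dg x w (Y x) z + g x (Y' w) z"
      by (simp add: sum.distrib g_expand[OF x, of "Y' w"])
  qed
  finally show ?thesis
    by (rule has_derivative_transform_within_open[OF _ open_domain x]) (simp add: g_expand)
qed

text \<open>The curvature on fields with constant components: the covariant derivative of w along v
  is \<Gamma>(v, w), and the bracket term vanishes.\<close>

definition curv :: "'e \<Rightarrow> 'e \<Rightarrow> 'e \<Rightarrow> 'e \<Rightarrow> 'e" where
  "curv x u v w = D\<Gamma> x u v w + \<Gamma> x u (\<Gamma> x v w) - (D\<Gamma> x v u w + \<Gamma> x v (\<Gamma> x u w))"

text \<open>Skewness is the symmetry of the second derivatives of \<open>g\<close>, computed by differentiating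
  metric compatibility once more.\<close>

lemma second_derivative_g:
  assumes x: "x \<in> S"
  shows "frechet_derivative (\<lambda>y. Dg y v w z) (at x) u =
    g x (\<Gamma> x u (\<Gamma> x v w)) z + g x (\<Gamma> x v w) (\<Gamma> x u z) + g x (D\<Gamma> x u v w) z +
    (g x (\<Gamma> x u (\<Gamma> x v z)) w + g x (\<Gamma> x v z) (\<Gamma> x u w) + g x (D\<Gamma> x u v z) w)"
proof -
  have "frechet_derivative (\<lambda>y. Dg y v w z) (at x) =
      frechet_derivative (\<lambda>y. g y (\<Gamma> y v w) z + g y (\<Gamma> y v z) w) (at x)"
    by (rule frechet_derivative_cong_open[OF open_domain x]) (simp add: \<Gamma>_compat g_commute)
  also have "\<dots> = (\<lambda>u. (Dg x u (\<Gamma> x v w) z + g x (D\<Gamma> x u v w) z) +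
      (Dg x u (\<Gamma> x v z) w + g x (D\<Gamma> x u v z) w))"
    by (intro frechet_derivative_eqI has_derivative_add has_derivative_g_field has_derivative_\<Gamma> x)
  finally show ?thesis by (simp add: \<Gamma>_compat[OF x])
qed

lemma curvature_form:
  assumes x: "x \<in> S"
  shows "curvature_form (g x) (curv x)"
proof -
  interpret inner_form "g x" by (rule inner_form[OF x])
  note bl = bilinear_ladd[OF \<Gamma>_bilinear[OF x]] bilinear_radd[OF \<Gamma>_bilinear[OF x]]
    bilinear_lmul[OF \<Gamma>_bilinear[OF x]] bilinear_rmul[OF \<Gamma>_bilinear[OF x]]
  show ?thesis
  proof (rule curvature_form.intro[OF inner_form[OF x]], rule curvature_form_axioms.intro)
    fix u v w z
    show "linear (\<lambda>u. curv x u v w)"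
      unfolding curv_def
      by (intro linearI) (simp_all add: bl linear_add[OF D\<Gamma>_linear[OF x]] linear_cmul[OF D\<Gamma>_linear[OF x]]
          linear_add[OF D\<Gamma>_linear_left[OF x]] linear_cmul[OF D\<Gamma>_linear_left[OF x]] algebra_simps)
    show "curv x v u w = - curv x u v w"
      by (simp add: curv_def)
    show "curv x u v w + curv x v w u + curv x w u v = 0"
      by (simp add: curv_def \<Gamma>_sym[OF x, of w u] \<Gamma>_sym[OF x, of v u] \<Gamma>_sym[OF x, of w v]
          D\<Gamma>_sym[OF x, of _ w u] D\<Gamma>_sym[OF x, of _ v u] D\<Gamma>_sym[OF x, of _ w v])
    \<comment> \<open>When the two expansions are compared, the products with one \<Gamma> in each
      slot of \<open>g x\<close> cancel, and what is left is skewness.\<close>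
    have "frechet_derivative (\<lambda>y. Dg y v w z) (at x) u = frechet_derivative (\<lambda>y. Dg y u w z) (at x) v"
      unfolding Dg_def
      by (rule second_derivative_symmetric[OF open_domain x differentiable differentiable2 differentiable2])
        (use x in auto)
    then show "g x (curv x u v w) z = - g x w (curv x u v z)"
      unfolding second_derivative_g[OF x] curv_def commute[of w] simps
      using commute[of "\<Gamma> x u w" "\<Gamma> x v z"] commute[of "\<Gamma> x v w" "\<Gamma> x u z"] by linarith
  qed
qed

end

section \<open>Charts and the Jacobi operator\<close>

lemma smooth_on_differentiable:
  assumes "smooth_on S f" "x \<in> S"
  shows "f differentiable (at x)" "(\<lambda>y. frechet_derivative f (at y) v) differentiable (at x)"
proof -
  have "Ck_on (Suc (Suc 0)) S f" using assms(1) unfolding smooth_on_def by blast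
  then show "f differentiable (at x)" "(\<lambda>y. frechet_derivative f (at y) v) differentiable (at x)"
    using assms(2) by auto
qed

lemma chart_on_facts:
  assumes "chart_on X c"
  shows "open (snd c ` fst c)" "inj_on (snd c) (fst c)" "fst c \<subseteq> topspace X"
    "\<And>A. openin X A \<Longrightarrow> open (snd c ` (fst c \<inter> A))"
proof -
  have o: "openin X (fst c)" and im: "open (snd c ` fst c)"
    and hom: "homeomorphic_map (subtopology X (fst c)) (top_of_set (snd c ` fst c)) (snd c)"
    using assms unfolding chart_on_def by auto
  show "open (snd c ` fst c)" by fact
  show sub: "fst c \<subseteq> topspace X" by (rule openin_subset[OF o])
  show "inj_on (snd c) (fst c)"
    using homeomorphic_imp_injective_map[OF hom] sub by (simp add: inf_absorb2)
  fix A assume "openin X A"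
  then have "openin (subtopology X (fst c)) (fst c \<inter> A)"
    by (simp add: openin_subtopology_Int2)
  then have "openin (top_of_set (snd c ` fst c)) (snd c ` (fst c \<inter> A))"
    using homeomorphic_imp_open_map[OF hom] by (simp add: open_map_def)
  then show "open (snd c ` (fst c \<inter> A))" using im by (rule openin_open_trans)
qed

lemma smooth_manifold_chart:
  assumes "smooth_manifold N" "c \<in> atlas N"
  shows "chart_on (top_of N) c"
  using assms unfolding smooth_manifold_def by blast

lemma smooth_manifold_chart_at:
  assumes "smooth_manifold N" "x \<in> points N"
  shows "chart_at N x \<in> atlas N" "x \<in> fst (chart_at N x)"
  using assms unfolding smooth_manifold_def by blast+

lemma chart_inv_chart:
  assumes "chart_on X c" "x \<in> fst c"
  shows "chart_inv c (snd c x) = x"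
  using assms chart_on_facts(2) unfolding chart_inv_def by (metis inv_into_f_f)

lemma transition_differentiable:
  assumes N: "smooth_manifold N" and c: "c \<in> atlas N" and d: "d \<in> atlas N"
    and x: "x \<in> fst c" "x \<in> fst d"
  shows "(snd d \<circ> chart_inv c) differentiable (at (snd c x))"
proof (rule smooth_on_differentiable(1))
  show "smooth_on (snd c ` (fst c \<inter> fst d)) (snd d \<circ> chart_inv c)"
    using N c d unfolding smooth_manifold_def by blast
  show "snd c x \<in> snd c ` (fst c \<inter> fst d)" using x by blast
qed

text \<open>The chain rule for the two coordinate changes, whose composite is the identity near
  \<open>snd c x\<close>.\<close>

lemma tangent_change_inverse:
  assumes N: "smooth_manifold N" and c: "c \<in> atlas N" and d: "d \<in> atlas N"
    and x: "x \<in> fst c" "x \<in> fst d"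
  shows "tangent_change d c x (tangent_change c d x u) = u"
proof -
  note cc = smooth_manifold_chart[OF N c] and dd = smooth_manifold_chart[OF N d]
  let ?U = "snd c ` (fst c \<inter> fst d)"
  have U: "open ?U" "snd c x \<in> ?U"
    using chart_on_facts(4)[OF cc, of "fst d"] dd x unfolding chart_on_def by auto
  have D: "((snd d \<circ> chart_inv c) has_derivative tangent_change c d x) (at (snd c x))"
    using transition_differentiable[OF assms]
    unfolding tangent_change_def frechet_derivative_works by simp
  have "((snd c \<circ> chart_inv d) has_derivative tangent_change d c x) (at (snd d x))"
    using transition_differentiable[OF N d c x(2) x(1)]
    unfolding tangent_change_def frechet_derivative_works by simp
  then have E: "((snd c \<circ> chart_inv d) has_derivative tangent_change d c x)
      (at ((snd d \<circ> chart_inv c) (snd c x)))"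
    using chart_inv_chart[OF cc x(1)] by simp
  have "((\<lambda>y. y) has_derivative (\<lambda>u. tangent_change d c x (tangent_change c d x u))) (at (snd c x))"
    using has_derivative_compose[OF D E]
    by (rule has_derivative_transform_within_open[OF _ U])
      (auto simp: chart_inv_chart[OF cc] chart_inv_chart[OF dd])
  from has_derivative_unique[OF this has_derivative_ident] show ?thesis
    by (simp add: fun_eq_iff)
qed

lemma tangent_change_linear:
  assumes "smooth_manifold N" "c \<in> atlas N" "d \<in> atlas N" "x \<in> fst c" "x \<in> fst d"
  shows "linear (tangent_change c d x)"
  unfolding tangent_change_def
  by (rule linear_frechet_derivative[OF transition_differentiable[OF assms]])

lemma tangent_change_self:
  assumes "smooth_manifold N" "c \<in> atlas N" "x \<in> fst c"
  shows "tangent_change c c x = (\<lambda>u. u)"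
proof -
  note cc = smooth_manifold_chart[OF assms(1,2)]
  show ?thesis
    unfolding tangent_change_def
    by (subst frechet_derivative_cong_open[OF chart_on_facts(1)[OF cc], where g = "\<lambda>y. y"])
      (use assms in \<open>auto simp: chart_inv_chart[OF cc] frechet_derivative_ident\<close>)
qed

section \<open>From the metric in a chart to the curvature of the manifold\<close>

lemma inner_product_pullback:
  assumes h: "inner_product h" and L: "linear L" "inj L"
  shows "inner_product (\<lambda>u v. h (L u) (L v))"
proof -
  have "bilinear (\<lambda>u v. h (L u) (L v))"
    using h L(1) linear_compose[OF L(1)] unfolding inner_product_def bilinear_def o_def by auto
  moreover have "L u \<noteq> 0" if "u \<noteq> 0" for u
    using that L by (metis injD linear_0)
  ultimately show ?thesis using h unfolding inner_product_def by auto
qed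

text \<open>At each coordinate the chart metric is the pullback of \<open>metric\<close> along
  \<open>of_comps\<close>, which is injective because changes of components are invertible.
  Smoothness supplies the two derivatives.\<close>

lemma local_metric_chart_metric:
  assumes R: "riemannian_manifold N" and c: "c \<in> atlas N"
  shows "local_metric (snd c ` fst c) (chart_metric N c)"
proof
  have N: "smooth_manifold N" using R unfolding riemannian_manifold_def by blast
  note cc = smooth_manifold_chart[OF N c]
  show "open (snd c ` fst c)" by (rule chart_on_facts(1)[OF cc])
  fix \<xi> assume \<xi>: "\<xi> \<in> snd c ` fst c"
  have sm: "smooth_on (snd c ` fst c) (\<lambda>\<xi>. chart_metric N c \<xi> u v)" for u v
    using R c unfolding riemannian_manifold_def by blast
  show "(\<lambda>\<xi>. chart_metric N c \<xi> u v) differentiable (at \<xi>)"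
    "(\<lambda>\<eta>. frechet_derivative (\<lambda>\<xi>. chart_metric N c \<xi> u v) (at \<eta>) w) differentiable (at \<xi>)" for u v w
    using smooth_on_differentiable[OF sm \<xi>] by auto
  obtain x where x: "x \<in> fst c" "\<xi> = snd c x" using \<xi> by blast
  have p: "x \<in> points N" using chart_on_facts(3)[OF cc] x unfolding points_def by blast
  note d = smooth_manifold_chart_at[OF N p]
  have i: "inj (of_comps N c x)"
    unfolding of_comps_def using tangent_change_inverse[OF N c d(1) x(1) d(2)] by (metis injI)
  have l: "linear (of_comps N c x)"
    unfolding of_comps_def by (rule tangent_change_linear[OF N c d(1) x(1) d(2)])
  have h: "inner_product (metric N x)"
    using R p unfolding riemannian_manifold_def by blast
  show "inner_product (chart_metric N c \<xi>)"
    unfolding chart_metric_def[abs_def] x(2) chart_inv_chart[OF cc x(1)] Let_def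
    by (rule inner_product_pullback[OF h l i])
qed

text \<open>In the chart chosen at \<open>x\<close>, tangent vectors at \<open>x\<close> are their
  own components, so the chart metric there is \<open>metric N x\<close> and the curvature tensor is
  \<open>curv\<close>.\<close>

lemma curvature_form_curvature:
  assumes R: "riemannian_manifold N" and x: "x \<in> points N"
  shows "curvature_form (metric N x) (curvature N x)"
proof -
  have N: "smooth_manifold N" using R unfolding riemannian_manifold_def by blast
  define c where "c = chart_at N x"
  have c: "c \<in> atlas N" "x \<in> fst c"
    using smooth_manifold_chart_at[OF N x] by (simp_all add: c_def)
  note cc = smooth_manifold_chart[OF N c(1)]
  interpret local_metric "snd c ` fst c" "chart_metric N c"
    by (rule local_metric_chart_metric[OF R c(1)])
  have "of_comps N c x = (\<lambda>u. u)"
    unfolding of_comps_def c_def[symmetric] by (rule tangent_change_self[OF N c])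
  then have g: "chart_metric N c (snd c x) = metric N x"
    unfolding chart_metric_def[abs_def] chart_inv_chart[OF cc c(2)] by simp
  have ch: "christoffel N c = \<Gamma>"
    unfolding christoffel_def[abs_def] \<Gamma>_def[abs_def] connection_def Dg_def ..
  have lc: "levi_civita N c (\<lambda>_. u) (\<lambda>_. w) = (\<lambda>\<xi>. \<Gamma> \<xi> u w)" for u w
    by (simp add: levi_civita_def[abs_def] ch frechet_derivative_const)
  have lb: "lie_bracket (\<lambda>_. u) (\<lambda>_. v) = (\<lambda>_. 0)" for u v :: 'b
    by (simp add: lie_bracket_def[abs_def] frechet_derivative_const)
  \<comment> \<open>Disposes of the bracket term, a covariant derivative along the zero
    field.\<close>
  have "\<Gamma> (snd c x) 0 w = 0" for w
    using c(2) by (intro bilinear_lzero \<Gamma>_bilinear) simp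
  then have "curvature N x u v w = curv (snd c x) u v w" for u v w
    unfolding curvature_def c_def[symmetric] curvature_field_def lb lc
    by (simp add: levi_civita_def ch curv_def D\<Gamma>_def)
  then have "curvature N x = curv (snd c x)" by blast
  then show ?thesis using curvature_form[of "snd c x"] c(2) g by simp
qed

section \<open>Immersions and the Jacobi operator\<close>

lemma smooth_map_linear_differential:
  assumes M: "smooth_manifold M" and N: "smooth_manifold N" and f: "smooth_map M N f"
    and m: "m \<in> points M"
  shows "f m \<in> points N" "linear (differential M N f m)"
proof -
  show fm: "f m \<in> points N"
    using f m continuous_map_image_subset_topspace[of "top_of M" "top_of N" f]
    unfolding smooth_map_def points_def by blast
  let ?c = "chart_at M m" and ?d = "chart_at N (f m)"
  note c = smooth_manifold_chart_at[OF M m] and d = smooth_manifold_chart_at[OF N fm]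
  have "smooth_on (snd ?c ` (fst ?c \<inter> f -` fst ?d)) (snd ?d \<circ> f \<circ> chart_inv ?c)"
    using f c(1) d(1) unfolding smooth_map_def by blast
  then show "linear (differential M N f m)"
    unfolding differential_def
    using c d by (intro linear_frechet_derivative smooth_on_differentiable(1)) auto
qed

text \<open>The shape operator and its transpose are definite descriptions, so zero must be shown to
  be their only solution; testing a solution against itself gives this.\<close>

lemma S_tilde_totally_geodesic:
  assumes "inner_product (metric M m)" "inner_product (metric N (f m))"
    and "totally_geodesic M N f" "m \<in> points M"
  shows "S_tilde M N f m v = 0"
proof -
  interpret M: inner_form "metric M m" by unfold_locales fact
  interpret N: inner_form "metric N (f m)" by unfold_locales fact
  have II: "second_fundamental_form M N f m a b = 0" for a b
    using assms(3,4) unfolding totally_geodesic_def by blast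
  have S: "shape_operator M N f m v a = 0" for v a
    unfolding shape_operator_def \<open>\<And>a b. second_fundamental_form M N f m a b = 0\<close>
  proof (rule the_equality)
    fix w assume "\<forall>b. metric M m w b = metric N (f m) 0 v"
    then show "w = 0" using M.eq_zero_iff[of w] by (simp add: N.simps)
  qed (simp add: M.simps N.simps)
  have "0 \<in> normal_space M N f m"
    by (simp add: normal_space_def N.simps)
  moreover have "w = 0" if "w \<in> normal_space M N f m" "\<forall>v\<in>normal_space M N f m. metric N (f m) w v = 0" for w
    using that N.eq_zero_iff by blast
  moreover have "sym2_inner M m (shape_operator M N f m v) A = 0" for A
    by (simp add: sym2_inner_def S M.simps)
  ultimately show ?thesis
    unfolding S_tilde_def shape_transpose_def
    by (intro the_equality) (simp_all add: N.simps)
qed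

theorem theorem2p1:
  fixes M :: "('m, 'b::euclidean_space) riem"
    and N :: "('a, 'e::euclidean_space) riem"
    and f :: "'m \<Rightarrow> 'a"
    and p n :: nat
    and s :: real
  assumes "riemannian_manifold M" and "p = DIM('b)"
    and "riemannian_manifold N" and "n = DIM('e)"
    and "einstein N" and "\<forall>x\<in>points N. scalar_curvature N x = s"
    and "immersion M N f" and "induced_metric M N f"
    and "totally_geodesic M N f"
  shows "(\<forall>V\<in>normal_sections M N f. \<forall>m\<in>points M.
            jacobi M N f V m =
              - laplacian M N f V m - (s / real n) *\<^sub>R V m + ricci_perp M N f m (V m)) \<and>
         (n = p + 1 \<longrightarrow>
           (\<forall>V\<in>normal_sections M N f. \<forall>m\<in>points M.
              jacobi M N f V m = - laplacian M N f V m - (s / real n) *\<^sub>R V m)) \<and>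
         (constant_curvature N \<longrightarrow>
           (\<forall>V\<in>normal_sections M N f. \<forall>m\<in>points M.
              jacobi M N f V m =
                - laplacian M N f V m - (s * (real p / (real n * (real n - 1)))) *\<^sub>R V m))"
proof -
  have "jacobi M N f V m =
          - laplacian M N f V m - (s / real n) *\<^sub>R V m + ricci_perp M N f m (V m) \<and>
        (n = p + 1 \<longrightarrow> jacobi M N f V m = - laplacian M N f V m - (s / real n) *\<^sub>R V m) \<and>
        (constant_curvature N \<longrightarrow> jacobi M N f V m =
          - laplacian M N f V m - (s * (real p / (real n * (real n - 1)))) *\<^sub>R V m)"
    if V: "V \<in> normal_sections M N f" and m: "m \<in> points M" for V m
  proof -
    have M: "smooth_manifold M" and N: "smooth_manifold N"
      using assms(1,3) unfolding riemannian_manifold_def by auto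
    have imm: "smooth_map M N f" "inj (differential M N f m)"
      using assms(7) m unfolding immersion_def by auto
    have fm: "f m \<in> points N" and lin: "linear (differential M N f m)"
      using smooth_map_linear_differential[OF M N imm(1) m] by auto
    let ?h = "metric N (f m)" and ?W = "range (differential M N f m)"
    interpret curvature_form ?h "curvature N (f m)"
      by (rule curvature_form_curvature[OF assms(3) fm])
    have W: "subspace ?W" by (rule linear_subspace_image[OF lin subspace_UNIV])
    have dimW: "dim ?W = p"
      using dim_image_eq[OF lin, of UNIV] imm(2) assms(2) by simp
    have ns: "normal_space M N f m = perp ?W"
      by (auto simp: normal_space_def perp_def)
    have np: "normal_part M N f m = perp_part ?W"
      unfolding normal_part_def[abs_def] perp_part_def[abs_def] ns ..
    have v: "V m \<in> perp ?W" using V m by (auto simp: normal_sections_def ns)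
    have n: "real n > 0" using assms(4) by simp
    have ric: "ricci N (f m) = ric"
      unfolding ricci_def[abs_def] ric_def[abs_def] ..
    have scal: "(\<Sum>e\<in>onb ?h UNIV. ric e e) = s"
      using assms(6) fm by (auto simp: scalar_curvature_def ric)
    obtain l where "\<forall>x\<in>points N. \<forall>u v. ricci N x u v = l * metric N x u v"
      using assms(5) unfolding einstein_def by blast
    then have l: "ric u v = l * ?h u v" for u v
      using fm by (simp flip: ric)
    have "s = l * real n"
      using einstein_scalar[OF l] unfolding scal assms(4) .
    then have ls: "l = s / real n" using n by simp
    have pr: "partial_ricci M N f m (V m) = (\<Sum>e\<in>onb ?h ?W. perp_part ?W (curvature N (f m) e (V m) e))"
      by (simp add: partial_ricci_def np)
    have rp: "ricci_perp M N f m (V m) =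
        - (\<Sum>e\<in>onb ?h (perp ?W). perp_part ?W (curvature N (f m) e (V m) e))"
      by (simp add: ricci_perp_def np ns)
    have S: "S_tilde M N f m (V m) = 0"
      using assms(1,3) m fm unfolding riemannian_manifold_def
      by (intro S_tilde_totally_geodesic assms(9)) auto
    have jac: "jacobi M N f V m = - laplacian M N f V m + partial_ricci M N f m (V m)"
      by (simp add: jacobi_def S)
    have 1: "jacobi M N f V m =
        - laplacian M N f V m - (s / real n) *\<^sub>R V m + ricci_perp M N f m (V m)"
      unfolding jac pr rp einstein_partial_ricci[OF l W v] ls by simp
    have 2: "jacobi M N f V m = - laplacian M N f V m - (s / real n) *\<^sub>R V m" if "n = p + 1"
      unfolding 1 rp using that assms(4) dimW
      by (simp add: hypersurface_ricci_perp[OF W v])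
    have 3: "jacobi M N f V m =
        - laplacian M N f V m - (s * (real p / (real n * (real n - 1)))) *\<^sub>R V m"
      if "constant_curvature N"
    proof -
      obtain k where k: "\<And>u v. independent {u, v} \<Longrightarrow> u \<noteq> v \<Longrightarrow>
          ?h (curvature N (f m) u v v) u / (?h u u * ?h v v - (?h u v)\<^sup>2) = k"
        using \<open>constant_curvature N\<close> fm
        unfolding constant_curvature_def sectional_curvature_def by blast
      have sk: "s = real n * (real n - 1) * k"
        using constant_curvature_scalar[OF k] scal assms(4) by simp
      have eq: "(s * (real p / (real n * (real n - 1)))) *\<^sub>R V m = (real p * k) *\<^sub>R V m"
      \<comment> \<open>For \<open>n = 1\<close> the quotient divides by zero and \<open>s\<close>
        does not determine \<open>k\<close>. But \<open>p\<close> is at least 1, so the differential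
        is onto and the normal vector \<open>V m\<close> is zero.\<close>
      proof (cases "n = 1")
        case True
        have "?W = UNIV"
          using dimW True assms(2,4) W dim_subset_UNIV[of ?W]
          by (metis DIM_positive One_nat_def dim_eq_full le_antisym less_eq_Suc_le span_eq_iff)
        then have "V m = 0" using v eq_zero_iff by (auto simp: perp_def)
        then show ?thesis by simp
      next
        case False
        then have "real n - 1 \<noteq> 0" by simp
        then show ?thesis using n unfolding sk by simp
      qed
      have "(\<Sum>e\<in>onb ?h ?W. perp_part ?W (curvature N (f m) e (V m) e)) = - ((real p * k) *\<^sub>R V m)"
        using constant_curvature_partial_ricci[OF k W v] unfolding dimW .
      then show ?thesis unfolding jac pr eq by simp
    qed
    show ?thesis using 1 2 3 by blast
  qed
  then show ?thesis by blast
qed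

end
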